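(* For real $\nu\ge 0$ let $L_\nu=\frac{1}{2\pi}\int_{-\pi}^{\pi}\left|\frac{\sin((\nu+\frac12)t)}{\sin(t/2)}\right|dt$, so that for integers $n\ge0$, $L_{n/2}=\frac{1}{2\pi}\int_{-\pi}^{\pi}\left|\frac{\sin((n+1)t/2)}{\sin(t/2)}\right|dt$. Let $$c_1=\frac{8}{\pi^2}\sum_{k=1}^{\infty}\frac{\ln k}{4k^2-1}+\frac{4}{\pi^2}(\gamma+2\ln 2),$$ where $\gamma$ is the Euler–Mascheroni constant, and let $\mathrm{MC}_0(n)=\frac{4}{\pi^2}\ln(n+1)+c_1$. With $y=(n+1)^2$ define $$\mathrm{MC}_1(n)=\frac{\rho_1}{y+\varrho_1},\qquad \mathrm{MC}_2(n)=\cfrac{\rho_1}{y+\varrho_1+\cfrac{\rho_2}{y+\varrho_2}},$$ where $$\rho_1=\frac{12-\pi^2}{18\pi^2},\qquad \varrho_1=\frac{7(-720+60\pi^2+\pi^4)}{600(-12+\pi^2)},$$ $$\rho_2=-\frac{7515244800-1252540800\pi^2+46937520\pi^4+65640\pi^6+23797\pi^8}{52920000(-12+\pi^2)^2},$$ $$\varrho_2=\frac{7(-36262162944000+9065540736000\pi^2-720128102400\pi^4+16206350400\pi^6+117169920\pi^8+288540\pi^{10}+230953\pi^{12})}{600(-90182937600+22545734400\pi^2-1815791040\pi^4+46149840\pi^6-219924\pi^8+23797\pi^{10})}.$$ For $k\in\{1,2\}$ let $E_k(n)=L_{n/2}-\mathrm{MC}_0(n)-\mathrm{MC}_k(n)$.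 Then for $k\in\{1,2\}$, $$\lim_{n\to\infty}n^{4k+3}\bigl(E_k(n)-E_k(n+1)\bigr)=(4k+2)C_k,\qquad \lim_{n\to\infty}n^{4k+2}E_k(n)=C_k,$$ where $$C_1=\frac{-7515244800+1252540800\pi^2-46937520\pi^4-65640\pi^6-23797\pi^8}{952560000\pi^2(-12+\pi^2)},$$ $$C_2=\frac{N_2}{97592743987200\pi^2(7515244800-1252540800\pi^2+46937520\pi^4+65640\pi^6+23797\pi^8)},$$ with $N_2=7633889107527073628160000-1908472276881768407040000\pi^2+146687085183488661504000\pi^4-3184401328004768256000\pi^6+50811629937851059200\pi^8-5860796365392595200\pi^{10}+73433337261096960\pi^{12}-2698623258901920\pi^{14}-13989723377364\pi^{16}-552278517605\pi^{18}$.
   Context: $\gamma=\lim_{n\to\infty}\left(\sum_{m=1}^n\frac1m-\ln n\right)$ is the Euler–Mascheroni constant. The numbers $L_n$ are the Lebesgue constants. *)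

theory Defs
  imports "HOL-Analysis.Analysis"
begin

text \<open>The integrand has a removable singularity at \<open>t = 0\<close>, where division by zero makes it \<open>0\<close>;
  this does not affect the integral.\<close>

definition lebesgue_const :: "real \<Rightarrow> real" where
  "lebesgue_const \<nu> =
     1 / (2 * pi) * integral {-pi..pi} (\<lambda>t. \<bar>sin ((\<nu> + 1/2) * t) / sin (t / 2)\<bar>)"

lemma lebesgue_const_half:
  fixes n :: nat
  shows "lebesgue_const (real n / 2) =
     1 / (2 * pi) * integral {-pi..pi} (\<lambda>t. \<bar>sin ((real n + 1) * t / 2) / sin (t / 2)\<bar>)"
proof -
  have "(real n / 2 + 1/2) * t = (real n + 1) * t / 2" for t :: real
    by (simp add: field_simps)
  then show ?thesis
    unfolding lebesgue_const_def by (simp only:)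
qed

text \<open>The series over \<open>k \<ge> 1\<close> is indexed by \<open>Suc k\<close> with \<open>k \<ge> 0\<close>.\<close>

definition c\<^sub>1 :: real where
  "c\<^sub>1 = 8 / pi^2 * (\<Sum>k. ln (real (Suc k)) / (4 * real (Suc k)^2 - 1))
        + 4 / pi^2 * (euler_mascheroni + 2 * ln 2)"

definition MC\<^sub>0 :: "nat \<Rightarrow> real" where
  "MC\<^sub>0 n = 4 / pi^2 * ln (real n + 1) + c\<^sub>1"

definition \<rho>\<^sub>1 :: real where
  "\<rho>\<^sub>1 = (12 - pi^2) / (18 * pi^2)"

text \<open>\<open>\<sigma>\<^sub>i\<close> stands for the shift usually written varrho with index \<open>i\<close>.\<close>

definition \<sigma>\<^sub>1 :: real where
  "\<sigma>\<^sub>1 = 7 * (-720 + 60 * pi^2 + pi^4) / (600 * (-12 + pi^2))"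

definition \<rho>\<^sub>2 :: real where
  "\<rho>\<^sub>2 = - ((7515244800 - 1252540800 * pi^2 + 46937520 * pi^4 + 65640 * pi^6 + 23797 * pi^8)
          / (52920000 * (-12 + pi^2)^2))"

definition \<sigma>\<^sub>2 :: real where
  "\<sigma>\<^sub>2 = 7 * (-36262162944000 + 9065540736000 * pi^2 - 720128102400 * pi^4
              + 16206350400 * pi^6 + 117169920 * pi^8 + 288540 * pi^10 + 230953 * pi^12)
        / (600 * (-90182937600 + 22545734400 * pi^2 - 1815791040 * pi^4
              + 46149840 * pi^6 - 219924 * pi^8 + 23797 * pi^10))"

definition MC\<^sub>1 :: "nat \<Rightarrow> real" where
  "MC\<^sub>1 n = (let y = (real n + 1)^2 in \<rho>\<^sub>1 / (y + \<sigma>\<^sub>1))"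

definition MC\<^sub>2 :: "nat \<Rightarrow> real" where
  "MC\<^sub>2 n = (let y = (real n + 1)^2 in \<rho>\<^sub>1 / (y + \<sigma>\<^sub>1 + \<rho>\<^sub>2 / (y + \<sigma>\<^sub>2)))"

definition C\<^sub>1 :: real where
  "C\<^sub>1 = (-7515244800 + 1252540800 * pi^2 - 46937520 * pi^4 - 65640 * pi^6 - 23797 * pi^8)
        / (952560000 * pi^2 * (-12 + pi^2))"

definition N\<^sub>2 :: real where
  "N\<^sub>2 = 7633889107527073628160000
        - 1908472276881768407040000 * pi^2
        + 146687085183488661504000 * pi^4
        - 3184401328004768256000 * pi^6
        + 50811629937851059200 * pi^8
        - 5860796365392595200 * pi^10
        + 73433337261096960 * pi^12
        - 2698623258901920 * pi^14
        - 13989723377364 * pi^16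
        - 552278517605 * pi^18"

definition C\<^sub>2 :: real where
  "C\<^sub>2 = N\<^sub>2 / (97592743987200 * pi^2 *
        (7515244800 - 1252540800 * pi^2 + 46937520 * pi^4 + 65640 * pi^6 + 23797 * pi^8))"

text \<open>The following three are only meaningful for \<open>k \<in> {1, 2}\<close>.\<close>

definition MC :: "nat \<Rightarrow> nat \<Rightarrow> real" where
  "MC k = (if k = 1 then MC\<^sub>1 else MC\<^sub>2)"

definition MC_error :: "nat \<Rightarrow> nat \<Rightarrow> real" where
  "MC_error k n = lebesgue_const (real n / 2) - MC\<^sub>0 n - MC k n"

definition MC_limit :: "nat \<Rightarrow> real" where
  "MC_limit k = (if k = 1 then C\<^sub>1 else C\<^sub>2)"

end

theory Submission
  imports Defs "HOL-Real_Asymp.Real_Asymp"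
begin

text \<open>
  Abel summation of the square wave series gives
  \<open>|sin x| = 8/\<pi> \<Sum> sin\<^sup>2 (k x) / (4 k\<^sup>2 - 1)\<close>. Since \<open>sin\<^sup>2 (m x) / sin x\<close> is a sum of sines of odd
  multiples of \<open>x\<close>, integrating termwise yields Szego's formula
  \<open>L = 16/\<pi>\<^sup>2 \<Sum> O (k N) / (4 k\<^sup>2 - 1)\<close> for \<open>N = n + 1\<close>, where \<open>O m\<close> is the sum of the first \<open>m\<close>
  reciprocals of odd numbers. Inserting the asymptotic expansion of \<open>O m\<close> gives an expansion of \<open>L\<close>
  in powers of \<open>1/N\<^sup>2\<close> with uniform error \<open>O(1/N^12)\<close>. Its coefficients involve
  \<open>\<Sum> k^(-2 j) / (4 k\<^sup>2 - 1)\<close>, which reduce to even zeta values; these come from integrating the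
  square wave repeatedly. The constants of the continued fractions are those for which the
  expansions agree up to the term with coefficient \<open>C\<^sub>1\<close> resp. \<open>C\<^sub>2\<close>.
\<close>

subsection \<open>The square wave and the Fourier series of the absolute sine\<close>

text \<open>The limits fix the accuracy. For \<open>k = 2\<close> the difference of errors is
  multiplied by \<open>n ^ 11\<close>, so everything beyond \<open>C\<^sub>2 / N ^ 10\<close> must
  be \<open>o(1 / n ^ 11)\<close>; hence five terms of the expansion of \<open>odd_harm\<close> and
  a bound of order 12. With this margin the remainders in \<open>E n\<close> and
  \<open>E (n + 1)\<close> vanish separately. The bound on \<open>odd_harm m\<close> must hold for
  all \<open>m > 0\<close> with one constant, since \<open>m = k N\<close> runs through infinitely
  many values for each \<open>N\<close>; it is obtained by telescoping an estimate of the
  increments. The square wave series converges only conditionally, and not uniformly near 0, so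
  neither its sum nor its first integration can come from a Weierstrass test. An explicit bound on
  \<open>{x..pi/2}\<close> takes that role, anchored at \<open>pi / 2\<close>. The coefficients are
  rational functions of \<open>p = pi^2\<close>, and the matching is an identity in
  \<open>p\<close>. Numerical input on pi enters only through \<open>pi^2 \<noteq> 12\<close> and
  \<open>\<Delta> (pi^2) > 0\<close>, which make the denominators nonzero.\<close>

definition square_wave :: "nat \<Rightarrow> real \<Rightarrow> real" where
  "square_wave K x = (\<Sum>k<K. sin ((2 * real k + 1) * x) / (2 * real k + 1))"

lemma two_sin_times_sum_cos_odd:
  fixes x :: real
  shows "2 * sin x * (\<Sum>k<K. cos ((2 * real k + 1) * x)) = sin (2 * real K * x)"
proof (induction K)
  case 0
  then show ?case by simp
next
  case (Suc K)
  have "2 * sin x * cos ((2 * real K + 1) * x)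
      = sin (x + (2 * real K + 1) * x) + sin (x - (2 * real K + 1) * x)"
    by (simp add: sin_add sin_diff)
  also have "x + (2 * real K + 1) * x = 2 * real (Suc K) * x"
    by (simp add: algebra_simps)
  also have "x - (2 * real K + 1) * x = - (2 * real K * x)"
    by (simp add: algebra_simps)
  finally show ?case
    using Suc by (simp add: distrib_left)
qed

lemma has_real_derivative_square_wave:
  "(square_wave K has_real_derivative (\<Sum>k<K. cos ((2 * real k + 1) * x))) (at x)"
proof -
  have "((\<lambda>x. \<Sum>k<K. sin ((2 * real k + 1) * x) / (2 * real k + 1)) has_real_derivative
          (\<Sum>k<K. cos ((2 * real k + 1) * x))) (at x)"
  proof (rule DERIV_sum)
    fix k
    have nz: "2 * real k + 1 \<noteq> 0" by linarith
    have "((\<lambda>x. sin ((2 * real k + 1) * x) / (2 * real k + 1)) has_real_derivative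
            cos ((2 * real k + 1) * x) * (2 * real k + 1) / (2 * real k + 1)) (at x)"
      by (intro DERIV_cdivide) (auto intro!: derivative_eq_intros)
    then show "((\<lambda>x. sin ((2 * real k + 1) * x) / (2 * real k + 1)) has_real_derivative
            cos ((2 * real k + 1) * x)) (at x)"
      using nz by simp
  qed
  then show ?thesis
    by (simp add: square_wave_def[abs_def])
qed

text \<open>The derivative of \<open>square_wave K\<close> is
  \<open>sin (2 * K * t) / (2 * sin t)\<close>, and one integration by parts of this oscillating
  function gains the factor \<open>1 / K\<close>. Because the sine increases up to
  \<open>pi / 2\<close>, the bound at \<open>x\<close> also serves all \<open>t\<close> in
  \<open>{x..pi/2}\<close>; the integration of the series relies on this uniformity.\<close>

lemma square_wave_diff_bound:
  assumes x: "0 < x" "x \<le> pi / 2" and K: "K > 0"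
  shows "\<bar>square_wave K x - square_wave K (pi / 2)\<bar> \<le> 1 / (real K * (sin x)\<^sup>2)"
proof -
  \<comment> \<open>The extra term is what one integration by parts of \<open>sin (2 K t) / (2 sin t)\<close> produces;
    it leaves a derivative of order \<open>1 / K\<close>.\<close>
  define F where "F = (\<lambda>t. square_wave K t + cos (2 * real K * t) / (4 * real K * sin t))"
  define F' where "F' = (\<lambda>t. - (cos (2 * real K * t) * cos t / (4 * real K * (sin t)\<^sup>2)))"
  have sx: "sin x > 0"
    using x by (intro sin_gt_zero) auto
  have mono: "sin x \<le> sin t" if "t \<in> {x..pi/2}" for t
    using that x by (intro sin_monotone_2pi_le) auto
  have der: "(F has_real_derivative F' t) (at t within {x..pi/2})" if t: "t \<in> {x..pi/2}" for t
  proof -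
    have st: "sin t > 0" using mono[OF t] sx by linarith
    have sm: "(\<Sum>k<K. cos ((2 * real k + 1) * t)) = sin (2 * real K * t) / (2 * sin t)"
      using two_sin_times_sum_cos_odd[of t K] st by (simp add: field_simps)
    have "(F has_real_derivative sin (2 * real K * t) / (2 * sin t) +
        ((- sin (2 * real K * t) * (2 * real K)) * (4 * real K * sin t) - 
           cos (2 * real K * t) * (4 * real K * cos t)) / ((4 * real K * sin t) * (4 * real K * sin t))) (at t)"
      unfolding F_def using st K
      by (auto intro!: derivative_eq_intros has_real_derivative_square_wave[of K t, unfolded sm])
    also have "sin (2 * real K * t) / (2 * sin t) +
        ((- sin (2 * real K * t) * (2 * real K)) * (4 * real K * sin t) - 
           cos (2 * real K * t) * (4 * real K * cos t)) / ((4 * real K * sin t) * (4 * real K * sin t)) = F' t"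
      unfolding F'_def using st K by (simp add: divide_simps power2_eq_square)
    finally show ?thesis by (rule has_field_derivative_at_within)
  qed
  have bnd: "norm (F' t) \<le> 1 / (4 * real K * (sin x)\<^sup>2)" if t: "t \<in> {x..pi/2}" for t
  proof -
    have "\<bar>cos (2 * real K * t) * cos t\<bar> \<le> 1 * 1"
      unfolding abs_mult by (intro mult_mono) auto
    moreover have "(sin x)\<^sup>2 \<le> (sin t)\<^sup>2"
      using mono[OF t] sx by (intro power_mono) auto
    ultimately show ?thesis
      unfolding F'_def using K sx by (simp add: abs_mult) (intro frac_le, auto)
  qed
  have "norm (F (pi/2) - F x) \<le> 1 / (4 * real K * (sin x)\<^sup>2) * norm (pi/2 - x)"
    using x by (intro field_differentiable_bound[OF _ der bnd]) auto
  also have "\<dots> \<le> 1 / (4 * real K * (sin x)\<^sup>2) * 2"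
    using x pi_less_4 by (intro mult_left_mono) auto
  finally have 1: "\<bar>F (pi/2) - F x\<bar> \<le> 1 / (2 * real K * (sin x)\<^sup>2)"
    by simp
  have corr: "\<bar>cos (2 * real K * t) / (4 * real K * sin t)\<bar> \<le> 1 / (4 * real K * (sin x)\<^sup>2)"
    if t: "t \<in> {x..pi/2}" for t
  proof -
    have st: "sin t > 0" using mono[OF t] sx by linarith
    have "(sin x)\<^sup>2 \<le> sin x"
      using sx sin_le_one[of x] by (simp add: power2_eq_square mult_left_le)
    also have "\<dots> \<le> sin t" by (rule mono[OF t])
    finally show ?thesis
      using K st sx by (simp add: abs_mult) (intro frac_le, auto)
  qed
  have 2: "\<bar>cos (2 * real K * x) / (4 * real K * sin x)\<bar> \<le> 1 / (4 * real K * (sin x)\<^sup>2)"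
    "\<bar>cos (2 * real K * (pi/2)) / (4 * real K * sin (pi/2))\<bar> \<le> 1 / (4 * real K * (sin x)\<^sup>2)"
    by (rule corr; use x in auto)+
  have 3: "1 / (real K * (sin x)\<^sup>2) = 1 / (2 * real K * (sin x)\<^sup>2) + 1 / (4 * real K * (sin x)\<^sup>2) + 1 / (4 * real K * (sin x)\<^sup>2)"
    using sx K by (simp add: divide_simps)
  show ?thesis
    using 1 2 unfolding 3 F_def by linarith
qed

lemma cos_odd_mult_half_pi: "cos ((2 * real k + 1) * (pi / 2)) = 0"
proof -
  have "(2 * real k + 1) * (pi / 2) = pi / 2 + real k * pi" by (simp add: field_simps)
  then show ?thesis by (simp only: cos_add) simp
qed

text \<open>At \<open>pi / 2\<close> the sines alternate in sign and the series is the Leibniz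
  series for \<open>pi / 4\<close>. This anchors the value that
  \<open>square_wave_diff_bound\<close> carries to the other points.\<close>

lemma square_wave_half_pi_tendsto: "(\<lambda>K. square_wave K (pi / 2)) \<longlonglongrightarrow> pi / 4"
proof -
  have "sin ((2 * real k + 1) * (pi / 2)) = (-1) ^ k" for k
  proof -
    have "(2 * real k + 1) * (pi / 2) = pi / 2 + real k * pi"
      by (simp add: field_simps)
    then show ?thesis
      using cos_npi[of k] by (simp only: sin_add) (simp add: mult.commute)
  qed
  then have *: "square_wave K (pi/2) = (\<Sum>k<K. (-1) ^ k * 1 / real (k * 2 + 1))" for K
    by (simp add: square_wave_def add.commute mult.commute)
  have "summable (\<lambda>k. (-1) ^ k * 1 / real (k * 2 + 1))"
    using summable_arctan_series[of 1] by simp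
  then have "(\<lambda>k. (-1) ^ k * 1 / real (k * 2 + 1)) sums (pi / 4)"
    unfolding pi_series by (rule summable_sums)
  then show ?thesis
    unfolding sums_def * .
qed

lemma square_wave_tendsto:
  assumes "0 < x" "x < pi"
  shows "(\<lambda>K. square_wave K x) \<longlonglongrightarrow> pi / 4"
proof -
  have *: "(\<lambda>K. square_wave K x) \<longlonglongrightarrow> pi / 4" if x: "0 < x" "x \<le> pi / 2" for x
  proof -
    have sx: "sin x > 0"
      using x by (intro sin_gt_zero) auto
    have "(\<lambda>K. square_wave K x - square_wave K (pi / 2)) \<longlonglongrightarrow> 0"
    proof (rule Lim_null_comparison)
      show "\<forall>\<^sub>F K in sequentially. norm (square_wave K x - square_wave K (pi / 2)) \<le> 1 / (real K * (sin x)\<^sup>2)"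
        using eventually_gt_at_top[of 0] by eventually_elim (use square_wave_diff_bound[OF x] in simp)
      have "(\<lambda>K. (1 / (sin x)\<^sup>2) * (1 / real K)) \<longlonglongrightarrow> (1 / (sin x)\<^sup>2) * 0"
        by (intro tendsto_intros lim_1_over_n)
      then show "(\<lambda>K. 1 / (real K * (sin x)\<^sup>2)) \<longlonglongrightarrow> 0"
        by (simp add: mult.commute)
    qed
    from tendsto_add[OF this square_wave_half_pi_tendsto] show ?thesis by simp
  qed
  show ?thesis
  proof (cases "x \<le> pi / 2")
    case True
    then show ?thesis using * assms by blast
  next
    case False
    \<comment> \<open>Odd frequencies make the wave symmetric about \<open>pi / 2\<close>.\<close>
    have "sin ((2 * real k + 1) * (pi - x)) = sin ((2 * real k + 1) * x)" for k
    proof -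
      have "(2 * real k + 1) * (pi - x) = (pi - (2 * real k + 1) * x) + 2 * real k * pi"
        by (simp add: algebra_simps)
      then show ?thesis
        using cos_npi[of "2*k"] sin_npi[of "2*k"] by (simp add: sin_add)
    qed
    then have "square_wave K x = square_wave K (pi - x)" for K
      by (simp add: square_wave_def)
    then show ?thesis using *[of "pi - x"] False assms by simp
  qed
qed

lemma sin_times_sin_odd:
  fixes y :: real
  shows "sin y * sin ((2 * real j + 1) * y) = (sin (real (Suc j) * y))\<^sup>2 - (sin (real j * y))\<^sup>2"
proof -
  define a b where ab: "a = real (Suc j) * y" "b = real j * y"
  have e: "y = a - b" "(2 * real j + 1) * y = a + b"
    by (simp_all add: ab algebra_simps)
  have "sin (a - b) * sin (a + b) = (sin a)\<^sup>2 - (sin b)\<^sup>2"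
    unfolding sin_add sin_diff
    using sin_cos_squared_add[of a] sin_cos_squared_add[of b] by algebra
  then show ?thesis using e unfolding ab by metis
qed

text \<open>In \<open>part\<close>, \<open>sin_times_sin_odd\<close> turns
  \<open>sin x * square_wave K x\<close> into differences of squares, and Abel summation uses
  \<open>1 / (2 k - 1) - 1 / (2 k + 1) = 2 / (4 k^2 - 1)\<close>. The boundary term left over is
  \<open>O(1 / K)\<close>.\<close>

lemma sin_square_sums:
  assumes "0 < x" "x < pi"
  shows "(\<lambda>k. (sin (real (Suc k) * x))\<^sup>2 / (4 * (real (Suc k))\<^sup>2 - 1)) sums (pi / 8 * sin x)"
proof -
  have part: "(\<Sum>k<K. (sin (real (Suc k) * x))\<^sup>2 / (4 * (real (Suc k))\<^sup>2 - 1))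
     = sin x * square_wave K x / 2 - (sin (real K * x))\<^sup>2 / (2 * (2 * real K + 1))" for K
  proof (induction K)
    case 0
    then show ?case by (simp add: square_wave_def)
  next
    case (Suc K)
    note sin_times_sin_odd[of x K]
    then have s: "sin x * (sin ((2 * real K + 1) * x) / (2 * real K + 1)) 
       = ((sin (real (Suc K) * x))\<^sup>2 - (sin (real K * x))\<^sup>2) / (2 * real K + 1)" by simp
    define u v where uv: "u = (sin (real (Suc K) * x))\<^sup>2" "v = (sin (real K * x))\<^sup>2"
    have sq: "4 * (real (Suc K))\<^sup>2 - 1 = (2 * real K + 1) * (2 * real K + 3)"
      by (simp add: power2_eq_square algebra_simps)
    have r: "(u - v) / (2 * real K + 1) / 2 - u / (2 * (2 * real (Suc K) + 1)) = 
       u / ((2 * real K + 1) * (2 * real K + 3)) - v / (2 * (2 * real K + 1))"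
      by (simp add: divide_simps) (simp add: algebra_simps)
    have sw: "square_wave (Suc K) x = square_wave K x + sin ((2 * real K + 1) * x) / (2 * real K + 1)"
      by (simp add: square_wave_def)
    have "sin x * square_wave (Suc K) x / 2 = sin x * square_wave K x / 2 + (u - v) / (2 * real K + 1) / 2"
      unfolding sw distrib_left s uv by (simp add: add_divide_distrib)
    with Suc r show ?case
      unfolding sum.lessThan_Suc sq uv by linarith
  qed
  have "(\<lambda>K. (sin (real K * x))\<^sup>2 / (2 * (2 * real K + 1))) \<longlonglongrightarrow> 0"
  proof (rule Lim_null_comparison)
    show "\<forall>\<^sub>F K in sequentially. norm ((sin (real K * x))\<^sup>2 / (2 * (2 * real K + 1))) \<le> 1 / (2 * (2 * real K + 1))"
      by (intro always_eventually allI) (auto intro!: divide_right_mono simp: abs_square_le_1)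
    show "(\<lambda>K. 1 / (2 * (2 * real K + 1))) \<longlonglongrightarrow> 0" by real_asymp
  qed
  from tendsto_diff[OF tendsto_divide[OF tendsto_mult[OF tendsto_const[of "sin x"] square_wave_tendsto[OF assms]] tendsto_const[of 2]] this]
  have "(\<lambda>K. sin x * square_wave K x / 2 - (sin (real K * x))\<^sup>2 / (2 * (2 * real K + 1))) \<longlonglongrightarrow> sin x * (pi / 4) / 2 - 0"
    by simp
  then show ?thesis unfolding sums_def part by (simp add: mult.commute)
qed

text \<open>Both sides have period pi, so \<open>x\<close> is reduced to \<open>y\<close> in
  \<open>[0, pi)\<close>. At \<open>y = 0\<close>, which \<open>sin_square_sums\<close> excludes,
  every term vanishes.\<close>

lemma abs_sin_square_sums:
  "(\<lambda>k. (sin (real (Suc k) * x))\<^sup>2 / (4 * (real (Suc k))\<^sup>2 - 1)) sums (pi / 8 * \<bar>sin x\<bar>)"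
proof -
  define y where "y = x - of_int \<lfloor>x / pi\<rfloor> * pi"
  have sq: "(sin (real m * x))\<^sup>2 = (sin (real m * y))\<^sup>2" for m
  proof -
    have e: "real m * x = real m * y + pi * of_int (int m * \<lfloor>x / pi\<rfloor>)"
      by (simp add: y_def algebra_simps)
    have "(cos (pi * of_int (int m * \<lfloor>x / pi\<rfloor>)))\<^sup>2 = 1"
      using sin_cos_squared_add[of "pi * of_int (int m * \<lfloor>x / pi\<rfloor>)"]
      by (simp only: sin_int_times_real sin_npi_int) simp
    then show ?thesis
      unfolding e sin_add by (simp only: sin_npi_int) (simp add: power_mult_distrib)
  qed
  have y: "0 \<le> y" "y < pi"
  proof -
    have "of_int \<lfloor>x / pi\<rfloor> \<le> x / pi" "x / pi < of_int \<lfloor>x / pi\<rfloor> + 1" by linarith+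
    then show "0 \<le> y" "y < pi"
      using pi_gt_zero unfolding y_def
      by (simp_all only: pos_le_divide_eq pos_divide_less_eq distrib_right)
  qed
  have "\<bar>sin x\<bar> = \<bar>sin y\<bar>"
    using sq[of 1] by (simp add: abs_eq_iff power2_eq_iff)
  also have "\<dots> = sin y" using y by (simp add: sin_ge_zero)
  finally have a: "\<bar>sin x\<bar> = sin y" .
  show ?thesis
  proof (cases "y = 0")
    case True
    then show ?thesis unfolding sq a by simp
  next
    case False
    then show ?thesis unfolding sq a using y by (intro sin_square_sums) auto
  qed
qed

subsection \<open>Sums of reciprocals of odd numbers\<close>

lemma inverse_power_diff:
  fixes h :: real
  assumes "\<bar>h\<bar> < 1"
  shows "1 / (1 + h) ^ n - 1 / (1 - h) ^ n = ((1 - h) ^ n - (1 + h) ^ n) / (1 - h\<^sup>2) ^ n"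
proof -
  have "1 - h\<^sup>2 = (1 + h) * (1 - h)" by (simp add: power2_eq_square algebra_simps)
  moreover have "1 + h \<noteq> 0" "1 - h \<noteq> 0" using assms by auto
  ultimately show ?thesis by (simp add: power_mult_distrib divide_simps)
qed

text \<open>The left side is the derivative of the function \<open>f\<close> of
  \<open>odd_harm_increment_bound\<close>; up to sign, 1/6, 7/30 and so on are \<open>2 j\<close>
  times the coefficients of \<open>odd_harm_tail\<close>. It is even in \<open>h\<close>, hence a
  rational function of \<open>w = h^2\<close> over the common denominator
  \<open>(1 - w) ^ 11\<close>. The five Bernoulli coefficients cancel \<open>w\<close> to
  \<open>w ^ 5\<close> in the numerator, which leaves the factor \<open>h ^ 12\<close>.\<close>

lemma harm_increment_deriv_eq:
  fixes h :: real
  assumes h: "\<bar>h\<bar> < 1"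
  shows "1 - (1 / (1 + h) + 1 / (1 - h)) / 2
     - 1/6 * (h * (1 / (1 + h) ^ 3 - 1 / (1 - h) ^ 3))
     + 7/30 * (h^3 * (1 / (1 + h) ^ 5 - 1 / (1 - h) ^ 5))
     - 31/42 * (h^5 * (1 / (1 + h) ^ 7 - 1 / (1 - h) ^ 7))
     + 127/30 * (h^7 * (1 / (1 + h) ^ 9 - 1 / (1 - h) ^ 9))
     - 2555/66 * (h^9 * (1 / (1 + h) ^ 11 - 1 / (1 - h) ^ 11))
   = h ^ 12 * ((1414477/105 + 1281841/35 * h^2 + 176126/7 * h^4 + 138146/35 * h^6
        + 92747/1155 * h^8 - h^10) / (1 - h\<^sup>2) ^ 11)" (is "?l = ?r")
proof -
  define w where "w = h\<^sup>2"
  define V where "V = 1 - w"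
  have V: "V \<noteq> 0" using h abs_square_less_1[of h] unfolding V_def w_def by simp
  have hp: "1 + h \<noteq> 0" "1 - h \<noteq> 0" using h by auto
  have Vh: "V = (1 + h) * (1 - h)" by (simp add: V_def w_def power2_eq_square algebra_simps)
  have t0: "1 - (1 / (1 + h) + 1 / (1 - h)) / 2 = (- w * V ^ 10) / V ^ 11"
  proof -
    have "1 - (1 / (1 + h) + 1 / (1 - h)) / 2 = - w / V"
      unfolding Vh w_def using hp by (simp add: divide_simps) (simp add: power2_eq_square algebra_simps)
    also have "\<dots> = (- w * V ^ 10) / V ^ 11"
      using V by (simp add: eval_nat_numeral)
    finally show ?thesis .
  qed
  note red = inverse_power_diff[OF h, folded w_def, folded V_def]
  have t1: "h * (1 / (1 + h) ^ 3 - 1 / (1 - h) ^ 3) = (-2 * w * (3 + w) * V^8) / V^11"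
  proof -
    have "h * ((1 - h) ^ 3 - (1 + h) ^ 3) = -2 * w * (3 + w)" unfolding w_def by algebra
    then show ?thesis unfolding red using V by (simp add: eval_nat_numeral flip: mult.assoc)
  qed
  have expand: "a / V ^ i = (a * V ^ j) / V ^ (i + j)" for a i j
    using V by (simp add: power_add)
  have t2: "h^3 * (1 / (1 + h) ^ 5 - 1 / (1 - h) ^ 5) = (-2 * w^2 * (5 + 10*w + w^2) * V^6) / V^11"
  proof -
    have "h^3 * ((1 - h) ^ 5 - (1 + h) ^ 5) = -2 * w^2 * (5 + 10*w + w^2)" unfolding w_def by algebra
    then have "h^3 * (1 / (1 + h) ^ 5 - 1 / (1 - h) ^ 5) = -2 * w^2 * (5 + 10*w + w^2) / V^5"
      unfolding red by simp
    then show ?thesis using expand[of _ 5 6] by simp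
  qed
  have t3: "h^5 * (1 / (1 + h) ^ 7 - 1 / (1 - h) ^ 7) = (-2 * w^3 * (7 + 35*w + 21*w^2 + w^3) * V^4) / V^11"
  proof -
    have "h^5 * ((1 - h) ^ 7 - (1 + h) ^ 7) = -2 * w^3 * (7 + 35*w + 21*w^2 + w^3)" unfolding w_def by algebra
    then have "h^5 * (1 / (1 + h) ^ 7 - 1 / (1 - h) ^ 7) = -2 * w^3 * (7 + 35*w + 21*w^2 + w^3) / V^7"
      unfolding red by simp
    then show ?thesis using expand[of _ 7 4] by simp
  qed
  have t4: "h^7 * (1 / (1 + h) ^ 9 - 1 / (1 - h) ^ 9) = (-2 * w^4 * (9 + 84*w + 126*w^2 + 36*w^3 + w^4) * V^2) / V^11"
  proof -
    have "h^7 * ((1 - h) ^ 9 - (1 + h) ^ 9) = -2 * w^4 * (9 + 84*w + 126*w^2 + 36*w^3 + w^4)" unfolding w_def by algebra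
    then have "h^7 * (1 / (1 + h) ^ 9 - 1 / (1 - h) ^ 9) = -2 * w^4 * (9 + 84*w + 126*w^2 + 36*w^3 + w^4) / V^9"
      unfolding red by simp
    then show ?thesis using expand[of _ 9 2] by simp
  qed
  have t5: "h^9 * (1 / (1 + h) ^ 11 - 1 / (1 - h) ^ 11) = (-2 * w^5 * (11 + 165*w + 462*w^2 + 330*w^3 + 55*w^4 + w^5)) / V^11"
  proof -
    have "h^9 * ((1 - h) ^ 11 - (1 + h) ^ 11) = -2 * w^5 * (11 + 165*w + 462*w^2 + 330*w^3 + 55*w^4 + w^5)" unfolding w_def by algebra
    then show ?thesis unfolding red by simp
  qed
  have num: "- w * V ^ 10 - 1/6 * (-2 * w * (3 + w) * V^8)
    + 7/30 * (-2 * w^2 * (5 + 10*w + w^2) * V^6)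
    - 31/42 * (-2 * w^3 * (7 + 35*w + 21*w^2 + w^3) * V^4)
    + 127/30 * (-2 * w^4 * (9 + 84*w + 126*w^2 + 36*w^3 + w^4) * V^2)
    - 2555/66 * (-2 * w^5 * (11 + 165*w + 462*w^2 + 330*w^3 + 55*w^4 + w^5))
    = w^6 * (1414477/105 + 1281841/35 * w + 176126/7 * w^2 + 138146/35 * w^3
        + 92747/1155 * w^4 - w^5)"
    unfolding V_def by algebra
  have "?l = (- w * V ^ 10 - 1/6 * (-2 * w * (3 + w) * V^8)
    + 7/30 * (-2 * w^2 * (5 + 10*w + w^2) * V^6)
    - 31/42 * (-2 * w^3 * (7 + 35*w + 21*w^2 + w^3) * V^4)
    + 127/30 * (-2 * w^4 * (9 + 84*w + 126*w^2 + 36*w^3 + w^4) * V^2)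
    - 2555/66 * (-2 * w^5 * (11 + 165*w + 462*w^2 + 330*w^3 + 55*w^4 + w^5))) / V ^ 11"
    unfolding t0 t1 t2 t3 t4 t5
    by (simp only: add_divide_distrib diff_divide_distrib times_divide_eq_right)
  also have "\<dots> = ?r"
    unfolding num unfolding V_def w_def by (simp flip: power_mult)
  finally show ?thesis .
qed


definition odd_harm :: "nat \<Rightarrow> real" where
  "odd_harm m = (\<Sum>j<m. 1 / (2 * real j + 1))"

text \<open>The \<open>j\<close>-th coefficient is \<open>B (4^j / 2 - 1) / (2 j)\<close> with the Bernoulli number \<open>B\<close> of index \<open>2 j\<close>;
  the argument is \<open>2 m\<close> for the partial sum of length \<open>m\<close>.\<close>

definition odd_harm_tail :: "real \<Rightarrow> real" where
  "odd_harm_tail x = 1/12 * (1/x)^2 - 7/120 * (1/x)^4 + 31/252 * (1/x)^6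
     - 127/240 * (1/x)^8 + 511/132 * (1/x)^10"

text \<open>The expression vanishes at \<open>h = 0\<close> and has derivative
  \<open>h ^ 12 * q h\<close> with \<open>q\<close> continuous, hence bounded, on
  \<open>{0..1/2}\<close>, away from its pole at 1. The mean value bound then gives the order
  13.\<close>

lemma odd_harm_increment_bound:
  obtains C where "C \<ge> 0"
    "\<And>h. 0 < h \<Longrightarrow> h \<le> 1/2 \<Longrightarrow>
       \<bar>h - (ln (1 + h) - ln (1 - h)) / 2 - odd_harm_tail ((1 + h) / h) + odd_harm_tail ((1 - h) / h)\<bar> \<le> C * h ^ 13"
proof -
  \<comment> \<open>Writing \<open>1 / x\<close> as \<open>h / (1 + h)\<close> and
    \<open>h / (1 - h)\<close> makes the function differentiable at \<open>h = 0\<close>, where the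
    arguments of \<open>odd_harm_tail\<close> would blow up.\<close>
  define f where "f = (\<lambda>h::real. h - (ln (1 + h) - ln (1 - h)) / 2
     - (1/12 * (h / (1 + h))^2 - 7/120 * (h / (1 + h))^4 + 31/252 * (h / (1 + h))^6
         - 127/240 * (h / (1 + h))^8 + 511/132 * (h / (1 + h))^10)
     + (1/12 * (h / (1 - h))^2 - 7/120 * (h / (1 - h))^4 + 31/252 * (h / (1 - h))^6
         - 127/240 * (h / (1 - h))^8 + 511/132 * (h / (1 - h))^10))"
  define q where "q = (\<lambda>h::real. (1414477/105 + 1281841/35 * h^2 + 176126/7 * h^4 + 138146/35 * h^6
        + 92747/1155 * h^8 - h^10) / (1 - h\<^sup>2) ^ 11)"
  have "continuous_on {0..1/2} q"
  proof -
    have "1 - h\<^sup>2 \<noteq> 0" if "h \<in> {0..1/2}" for h :: real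
      using that abs_square_less_1[of h] by auto
    then show ?thesis unfolding q_def by (intro continuous_intros) auto
  qed
  then have "bounded (q ` {0..1/2})"
    by (intro compact_imp_bounded compact_continuous_image) auto
  then obtain C where C: "C > 0" "\<And>h. h \<in> {0..1/2} \<Longrightarrow> \<bar>q h\<bar> \<le> C"
    unfolding bounded_pos by auto
  have dp: "((\<lambda>h::real. (h / (1 + h)) ^ k) has_real_derivative (real k * (h ^ (k - 1) * (1 / (1 + h) ^ (k + 1))))) (at h)"
    if h: "0 \<le> h" and k: "k > 0" for h k
  proof -
    obtain n where n: "k = Suc n" using k gr0_implies_Suc by blast
    have "((\<lambda>h::real. (h / (1 + h)) ^ Suc n) has_real_derivative
       (1 + real n) * ((h / (1 + h)) ^ n * ((1 * (1 + h) - h * (0 + 1)) / ((1 + h) * (1 + h))))) (at h)"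
      using h by (intro derivative_eq_intros | simp)+
    also have "(1 + real n) * ((h / (1 + h)) ^ n * ((1 * (1 + h) - h * (0 + 1)) / ((1 + h) * (1 + h))))
       = real (Suc n) * (h ^ n * (1 / (1 + h) ^ (n + 2)))"
      by (simp add: power_divide power_add power2_eq_square)
    finally show ?thesis by (simp add: n)
  qed
  have dm: "((\<lambda>h::real. (h / (1 - h)) ^ k) has_real_derivative (real k * (h ^ (k - 1) * (1 / (1 - h) ^ (k + 1))))) (at h)"
    if h: "h \<le> 1/2" and k: "k > 0" for h k
  proof -
    obtain n where n: "k = Suc n" using k gr0_implies_Suc by blast
    have "((\<lambda>h::real. (h / (1 - h)) ^ Suc n) has_real_derivative
       (1 + real n) * ((h / (1 - h)) ^ n * ((1 * (1 - h) - h * (0 - 1)) / ((1 - h) * (1 - h))))) (at h)"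
      using h by (intro derivative_eq_intros | simp)+
    also have "(1 + real n) * ((h / (1 - h)) ^ n * ((1 * (1 - h) - h * (0 - 1)) / ((1 - h) * (1 - h))))
       = real (Suc n) * (h ^ n * (1 / (1 - h) ^ (n + 2)))"
      by (simp add: power_divide power_add power2_eq_square)
    finally show ?thesis by (simp add: n)
  qed
  have der: "(f has_real_derivative t ^ 12 * q t) (at t)" if t: "t \<in> {0..1/2}" for t
  proof -
    have t': "\<bar>t\<bar> < 1" "0 \<le> t" "t \<le> 1/2" using t by auto
    note p = dp[OF t'(2)] and m = dm[OF t'(3)]
    have l: "((\<lambda>h. h - (ln (1 + h) - ln (1 - h)) / 2) has_real_derivative
               1 - (1 / (1 + t) + 1 / (1 - t)) / 2) (at t)"
      using t' by (auto intro!: derivative_eq_intros)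
    have P: "((\<lambda>h. 1/12 * (h / (1 + h))^2 - 7/120 * (h / (1 + h))^4 + 31/252 * (h / (1 + h))^6
         - 127/240 * (h / (1 + h))^8 + 511/132 * (h / (1 + h))^10) has_real_derivative
       1/12 * (2 * (t * (1 / (1 + t) ^ 3))) - 7/120 * (4 * (t^3 * (1 / (1 + t) ^ 5)))
       + 31/252 * (6 * (t^5 * (1 / (1 + t) ^ 7))) - 127/240 * (8 * (t^7 * (1 / (1 + t) ^ 9)))
       + 511/132 * (10 * (t^9 * (1 / (1 + t) ^ 11)))) (at t)"
      by (intro DERIV_add DERIV_diff DERIV_cmult)
        (use p[of 2] p[of 4] p[of 6] p[of 8] p[of 10] in simp_all)
    have M: "((\<lambda>h. 1/12 * (h / (1 - h))^2 - 7/120 * (h / (1 - h))^4 + 31/252 * (h / (1 - h))^6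
         - 127/240 * (h / (1 - h))^8 + 511/132 * (h / (1 - h))^10) has_real_derivative
       1/12 * (2 * (t * (1 / (1 - t) ^ 3))) - 7/120 * (4 * (t^3 * (1 / (1 - t) ^ 5)))
       + 31/252 * (6 * (t^5 * (1 / (1 - t) ^ 7))) - 127/240 * (8 * (t^7 * (1 / (1 - t) ^ 9)))
       + 511/132 * (10 * (t^9 * (1 / (1 - t) ^ 11)))) (at t)"
      by (intro DERIV_add DERIV_diff DERIV_cmult)
        (use m[of 2] m[of 4] m[of 6] m[of 8] m[of 10] in simp_all)
    show ?thesis
      unfolding q_def harm_increment_deriv_eq[OF t'(1), symmetric] f_def
      by (rule DERIV_cong[OF DERIV_add[OF DERIV_diff[OF l P] M]]) (simp add: right_diff_distrib)
  qed
  have main: "\<bar>f h\<bar> \<le> C * h ^ 13" if h: "0 < h" "h \<le> 1/2" for h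
  proof -
    have "norm (f h - f 0) \<le> (C * h ^ 12) * norm (h - 0)"
    proof (rule field_differentiable_bound[of "{0..h}" f "\<lambda>t. t ^ 12 * q t"])
      fix t assume t: "t \<in> {0..h}"
      then show "(f has_real_derivative t ^ 12 * q t) (at t within {0..h})"
        using h by (auto intro: has_field_derivative_at_within[OF der])
      have "\<bar>t ^ 12\<bar> * \<bar>q t\<bar> \<le> h ^ 12 * C"
        using t h C by (intro mult_mono) (auto intro!: power_mono)
      then show "norm (t ^ 12 * q t) \<le> C * h ^ 12" by (simp add: abs_mult mult.commute)
    qed (use h in auto)
    moreover have "f 0 = 0" by (simp add: f_def)
    moreover have "h ^ 13 = h ^ 12 * h" using power_add[of h 12 1] by simp
    ultimately show ?thesis using h by simp
  qed
  show thesis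
  proof (rule that[of C])
    show "C \<ge> 0" using C by simp
    fix h :: real assume h: "0 < h" "h \<le> 1/2"
    show "\<bar>h - (ln (1 + h) - ln (1 - h)) / 2 - odd_harm_tail ((1 + h) / h) + odd_harm_tail ((1 - h) / h)\<bar> \<le> C * h ^ 13"
      using main[OF h] by (simp add: f_def odd_harm_tail_def)
  qed
qed

lemma odd_harm_eq_harm: "odd_harm m = harm (2 * m) - harm m / 2"
proof (induction m)
  case 0
  then show ?case by (simp add: odd_harm_def harm_def)
next
  case (Suc m)
  have "harm (2 * Suc m) = harm (2 * m) + 1 / (2 * real m + 1) + 1 / (real (Suc m) * 2)"
    by (simp add: harm_Suc inverse_eq_divide add_ac)
  moreover have "harm (Suc m) / 2 = harm m / 2 + 1 / (real (Suc m) * 2)"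
    by (simp add: harm_Suc inverse_eq_divide add_divide_distrib)
  moreover have "odd_harm (Suc m) = odd_harm m + 1 / (2 * real m + 1)"
    by (simp add: odd_harm_def)
  ultimately show ?case using Suc by linarith
qed

text \<open>The constant comes from \<open>harm (2 * m) - harm m / 2\<close>: half of the
  Euler-Mascheroni constant survives, and \<open>ln (2 * m)\<close> contributes the
  \<open>ln 2\<close>.\<close>

lemma odd_harm_minus_ln_tendsto:
  "(\<lambda>m. odd_harm m - ln (real m) / 2) \<longlonglongrightarrow> (euler_mascheroni + 2 * ln 2) / 2"
proof -
  have "filterlim (\<lambda>m::nat. 2 * m) at_top sequentially"
    by (rule filterlim_subseq) (auto simp: strict_mono_def)
  from filterlim_compose[OF euler_mascheroni_LIMSEQ this]
  have "(\<lambda>m. harm (2 * m) - ln (real (2 * m))) \<longlonglongrightarrow> (euler_mascheroni :: real)"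
    by simp
  then have "(\<lambda>m. (harm (2 * m) - ln (real (2 * m))) - (harm m - ln (real m)) / 2 + ln 2)
     \<longlonglongrightarrow> euler_mascheroni - euler_mascheroni / 2 + (ln 2 :: real)"
    by (intro tendsto_intros euler_mascheroni_LIMSEQ) auto
  then have "(\<lambda>m. (harm (2 * m) - ln (real (2 * m))) - (harm m - ln (real m)) / 2 + ln 2)
     \<longlonglongrightarrow> (euler_mascheroni + 2 * ln 2) / 2"
    by (simp add: field_simps)
  then show ?thesis
  proof (rule Lim_transform_eventually)
    show "\<forall>\<^sub>F m in sequentially. (harm (2 * m) - ln (real (2 * m))) - (harm m - ln (real m)) / 2 + ln 2
       = odd_harm m - ln (real m) / 2"
      using eventually_gt_at_top[of 0]
      by eventually_elim (simp add: odd_harm_eq_harm ln_mult field_simps)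
  qed
qed

text \<open>The remainder \<open>G\<close> tends to 0 and its increments are dominated by those of
  \<open>C / m ^ 12\<close>. Summing the increments from \<open>m\<close> to infinity bounds
  \<open>G m\<close>, with the same \<open>C\<close> for every \<open>m > 0\<close>.\<close>

lemma odd_harm_expansion:
  obtains C where "C \<ge> 0"
    "\<And>m. m > 0 \<Longrightarrow> \<bar>odd_harm m - (ln (real m) + euler_mascheroni + 2 * ln 2) / 2 - odd_harm_tail (2 * real m)\<bar>
        \<le> C / real m ^ 12"
proof -
  obtain C where C: "C \<ge> 0" "\<And>h. 0 < h \<Longrightarrow> h \<le> 1/2 \<Longrightarrow>
       \<bar>h - (ln (1 + h) - ln (1 - h)) / 2 - odd_harm_tail ((1 + h) / h) + odd_harm_tail ((1 - h) / h)\<bar> \<le> C * h ^ 13"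
    using odd_harm_increment_bound by blast
  define G where "G = (\<lambda>m. odd_harm m - (ln (real m) + euler_mascheroni + 2 * ln 2) / 2 - odd_harm_tail (2 * real m))"
  have step: "\<bar>G (Suc m) - G m\<bar> \<le> C * (1 / real m ^ 12 - 1 / real (Suc m) ^ 12)" if m: "m > 0" for m
  proof -
    \<comment> \<open>With this \<open>h\<close> the increment becomes an odd function of \<open>h\<close>, because \<open>m\<close> and \<open>m + 1\<close> are
      \<open>(1 - h) / (2 h)\<close> and \<open>(1 + h) / (2 h)\<close>.\<close>
    define h where "h = 1 / (2 * real m + 1)"
    have h: "0 < h" "h \<le> 1/2" using m by (auto simp: h_def field_simps)
    have e1: "(1 + h) / h = 2 * real (Suc m)" "(1 - h) / h = 2 * real m"
      using m by (auto simp: h_def field_simps)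
    have "(1 + h) = real (Suc m) * (2 * h)" "(1 - h) = real m * (2 * h)"
      using e1 h by (simp_all add: field_simps)
    then have e2: "ln (1 + h) - ln (1 - h) = ln (real (Suc m)) - ln (real m)"
      using h m by (simp add: ln_mult)
    have "G (Suc m) - G m = h - (ln (1 + h) - ln (1 - h)) / 2 - odd_harm_tail ((1 + h) / h) + odd_harm_tail ((1 - h) / h)"
      unfolding G_def e1 e2 by (simp add: odd_harm_def h_def field_simps)
    then have "\<bar>G (Suc m) - G m\<bar> \<le> C * h ^ 13"
      using C(2)[OF h] by simp
    \<comment> \<open>Of the thirteen factors, two are bounded by \<open>a * b\<close>, which equals
      \<open>a - b\<close>, and eleven by \<open>b\<close>.\<close>
    also have "h ^ 13 \<le> 1 / real m ^ 12 - 1 / real (Suc m) ^ 12"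
    proof -
      define a where "a = 1 / real m"
      define b where "b = 1 / real (Suc m)"
      have ab: "0 < b" "b \<le> a" "h \<le> b" "h \<le> a" "a - b = a * b"
        using m by (auto simp: a_def b_def h_def field_simps)
      have "h ^ 13 = h * h * h ^ 11" by (simp add: eval_nat_numeral)
      also have "\<dots> \<le> a * b * b ^ 11" using ab h by (intro mult_mono power_mono) auto
      also have "\<dots> = a * b ^ 11 - b * b ^ 11" using ab(5) by (simp add: left_diff_distrib flip: ab(5))
      also have "\<dots> \<le> a * a ^ 11 - b * b ^ 11"
        using ab by (intro diff_right_mono mult_left_mono power_mono) auto
      also have "\<dots> = a ^ 12 - b ^ 12" by (simp add: eval_nat_numeral)
      finally show ?thesis by (simp add: a_def b_def power_divide)
    qed
    finally show ?thesis using C(1) by (simp add: mult_left_mono)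
  qed
  have lim: "G \<longlonglongrightarrow> 0"
  proof -
    have "(\<lambda>m::nat. odd_harm_tail (2 * real m)) \<longlonglongrightarrow> 0"
      unfolding odd_harm_tail_def by real_asymp
    from tendsto_diff[OF tendsto_diff[OF odd_harm_minus_ln_tendsto tendsto_const[of "(euler_mascheroni + 2 * ln 2) / 2"]] this]
    show ?thesis by (simp add: G_def add_divide_distrib algebra_simps)
  qed
  have lim': "(\<lambda>m. G (m + k) - C * (1 / real (m + k) ^ 12)) \<longlonglongrightarrow> 0"
      "(\<lambda>m. - G (m + k) - C * (1 / real (m + k) ^ 12)) \<longlonglongrightarrow> 0" for k
  proof -
    have z: "(\<lambda>m. 1 / real (m + k) ^ 12) \<longlonglongrightarrow> 0" by real_asymp
    have g: "(\<lambda>m. G (m + k)) \<longlonglongrightarrow> 0" using lim by (rule LIMSEQ_ignore_initial_segment)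
    show "(\<lambda>m. G (m + k) - C * (1 / real (m + k) ^ 12)) \<longlonglongrightarrow> 0"
      using tendsto_diff[OF g tendsto_mult[OF tendsto_const[of C] z]] by simp
    show "(\<lambda>m. - G (m + k) - C * (1 / real (m + k) ^ 12)) \<longlonglongrightarrow> 0"
      using tendsto_diff[OF tendsto_minus[OF g] tendsto_mult[OF tendsto_const[of C] z]] by simp
  qed
  show thesis
  proof (rule that[of C])
    fix m :: nat assume m: "m > 0"
    \<comment> \<open>Both sequences increase and tend to 0, so they are nonpositive; this is the
      two-sided bound.\<close>
    have inc: "incseq (\<lambda>i. G (i + m) - C * (1 / real (i + m) ^ 12))"
      "incseq (\<lambda>i. - G (i + m) - C * (1 / real (i + m) ^ 12))"
      by (rule incseq_SucI; use step[of "_ + m"] m in \<open>simp add: right_diff_distrib abs_le_iff\<close>; smt (verit))+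
    have "G m - C * (1 / real m ^ 12) \<le> 0" "- G m - C * (1 / real m ^ 12) \<le> 0"
      using incseq_le[OF inc(1) lim'(1), of 0] incseq_le[OF inc(2) lim'(2), of 0] by simp_all
    then show "\<bar>odd_harm m - (ln (real m) + euler_mascheroni + 2 * ln 2) / 2 - odd_harm_tail (2 * real m)\<bar>
        \<le> C / real m ^ 12"
      unfolding G_def abs_le_iff by simp
  qed (rule C)
qed

subsection \<open>Szego's formula\<close>

lemma sin_times_sum_sin_odd:
  fixes y :: real
  shows "sin y * (\<Sum>j<m. sin ((2 * real j + 1) * y)) = (sin (real m * y))\<^sup>2"
  by (induction m) (simp_all only: lessThan_0 sum.empty sum.lessThan_Suc distrib_left sin_times_sin_odd, simp_all)

lemma has_integral_reflect_even:
  fixes f :: "real \<Rightarrow> real"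
  assumes "(f has_integral i) {0..a}" "0 \<le> a" "\<And>x. f (- x) = f x"
  shows "(f has_integral 2 * i) {-a..a}"
proof -
  have "((\<lambda>x. f (- x)) has_integral i) {-a..-0}"
    using assms(1) by (subst has_integral_reflect_real)
  then have "(f has_integral i) {-a..0}"
    by (simp add: assms(3))
  from has_integral_combine[OF _ _ this assms(1)] assms(2) show ?thesis by simp
qed

lemma has_integral_sin_odd_half:
  "((\<lambda>t. sin ((2 * real j + 1) * (t / 2))) has_integral 2 / (2 * real j + 1)) {0..pi}"
proof -
  define F where "F = (\<lambda>t. - 2 * cos ((2 * real j + 1) * (t / 2)) / (2 * real j + 1))"
  have nz: "2 * real j + 1 \<noteq> 0" by linarith
  have "((\<lambda>t. sin ((2 * real j + 1) * (t / 2))) has_integral F pi - F 0) {0..pi}"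
  proof (rule fundamental_theorem_of_calculus)
    fix t
    have "(F has_real_derivative - 2 * (- sin ((2 * real j + 1) * (t / 2)) * ((2 * real j + 1) * (1 / 2))) / (2 * real j + 1)) (at t)"
      unfolding F_def by (intro DERIV_cdivide DERIV_cmult) (auto intro!: derivative_eq_intros)
    also have "- 2 * (- sin ((2 * real j + 1) * (t / 2)) * ((2 * real j + 1) * (1 / 2))) / (2 * real j + 1)
       = sin ((2 * real j + 1) * (t / 2))"
      using nz by simp
    finally show "(F has_vector_derivative sin ((2 * real j + 1) * (t / 2))) (at t within {0..pi})"
      by (simp add: has_real_derivative_iff_has_vector_derivative has_vector_derivative_at_within)
  qed simp
  then show ?thesis
    unfolding F_def cos_odd_mult_half_pi by simp
qed

lemma has_integral_sin_square_kernel: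
  "((\<lambda>t. (sin (real m * (t / 2)))\<^sup>2 / \<bar>sin (t / 2)\<bar>) has_integral 4 * odd_harm m) {-pi..pi}"
proof -
  have "((\<lambda>t. \<Sum>j<m. sin ((2 * real j + 1) * (t / 2))) has_integral (\<Sum>j<m. 2 / (2 * real j + 1))) {0..pi}"
    by (intro has_integral_sum has_integral_sin_odd_half) auto
  also have "(\<Sum>j<m. 2 / (2 * real j + 1)) = 2 * odd_harm m"
    by (simp add: odd_harm_def sum_distrib_left)
  finally have "((\<lambda>t. (sin (real m * (t / 2)))\<^sup>2 / \<bar>sin (t / 2)\<bar>) has_integral 2 * odd_harm m) {0..pi}"
  proof (rule has_integral_eq[rotated])
    fix t assume t: "t \<in> {0..pi}"
    show "(\<Sum>j<m. sin ((2 * real j + 1) * (t / 2))) = (sin (real m * (t / 2)))\<^sup>2 / \<bar>sin (t / 2)\<bar>"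
    \<comment> \<open>At \<open>t = 0\<close> the quotient is 0 by the convention on division by
      zero, and the sum of sines is 0 as well, so there is no exceptional point.\<close>
    proof (cases "t = 0")
      case False
      then have "sin (t / 2) > 0" using t by (intro sin_gt_zero) auto
      then show ?thesis using sin_times_sum_sin_odd[of "t/2" m] by (simp add: field_simps)
    qed simp
  qed
  from has_integral_reflect_even[OF this] show ?thesis by simp
qed

text \<open>The continuous factor \<open>U\<close> with \<open>sin (N y) = sin y * U y\<close> is a
  Chebyshev polynomial of the second kind in \<open>cos y\<close>, built here from the addition
  formula. On \<open>{-pi..pi}\<close> the kernel differs from \<open>\<bar>U (t / 2)\<bar>\<close>
  at most at \<open>t = 0\<close>.\<close>

lemma integrable_lebesgue_kernel:
  "(\<lambda>t. \<bar>sin (real N * (t / 2)) / sin (t / 2)\<bar>) integrable_on {-pi..pi}"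
proof -
  have "\<exists>U. continuous_on UNIV U \<and> (\<forall>y. sin (real N * y) = sin y * U y)"
  proof (induction N)
    case 0
    show ?case by (rule exI[of _ "\<lambda>_. 0"]) auto
  next
    case (Suc N)
    then obtain U where U: "continuous_on UNIV U" "\<And>y. sin (real N * y) = sin y * U y" by blast
    have "sin (real (Suc N) * y) = sin y * (U y * cos y + cos (real N * y))" for y
    proof -
      have "sin (real (Suc N) * y) = sin (real N * y + y)" by (simp add: algebra_simps)
      also have "\<dots> = sin y * U y * cos y + cos (real N * y) * sin y"
        by (simp only: sin_add U(2))
      finally show ?thesis by (simp only: distrib_left mult_ac)
    qed
    then show ?case
      by (intro exI[of _ "\<lambda>y. U y * cos y + cos (real N * y)"]) (auto intro!: continuous_intros U(1))
  qed
  then obtain U where U: "continuous_on UNIV U" "\<And>y. sin (real N * y) = sin y * U y" by blast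
  have "continuous_on {-pi..pi} (\<lambda>t. \<bar>U (t / 2)\<bar>)"
  proof (rule continuous_on_rabs, rule continuous_on_compose2[OF U(1)])
    show "continuous_on {-pi..pi} (\<lambda>t. t / 2)"
      by (simp add: continuous_on_divide)
  qed simp
  then have "(\<lambda>t. \<bar>U (t / 2)\<bar>) integrable_on {-pi..pi}"
    by (rule integrable_continuous_interval)
  then show ?thesis
  proof (rule integrable_spike_finite[of "{0}", rotated 2])
    fix t assume t: "t \<in> {-pi..pi} - {0}"
    have "sin (t / 2) \<noteq> 0"
    proof
      assume "sin (t / 2) = 0"
      then have "t / 2 = 0" by (rule sin_eq_0_pi[rotated 2]) (use t pi_gt_zero in auto)
      then show False using t by simp
    qed
    then show "\<bar>sin (real N * (t / 2)) / sin (t / 2)\<bar> = \<bar>U (t / 2)\<bar>"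
      by (simp only: U(2)) simp
  qed simp
qed

text \<open>The terms of the series for the absolute sine are nonnegative, so its partial sums,
  divided by \<open>\<bar>sin (t / 2)\<bar>\<close>, are dominated by their own limit
  \<open>g\<close>. Dominated convergence then permits termwise integration.\<close>

lemma lebesgue_const_sums:
  "(\<lambda>k. odd_harm (Suc k * (n + 1)) / (4 * real (Suc k)^2 - 1)) sums (pi\<^sup>2 / 16 * lebesgue_const (real n / 2))"
proof -
  define N where "N = n + 1"
  define c where "c = (\<lambda>k. 1 / (4 * real (Suc k)^2 - 1))"
  define f where "f = (\<lambda>K t. \<Sum>k<K. c k * ((sin (real (Suc k * N) * (t / 2)))\<^sup>2 / \<bar>sin (t / 2)\<bar>))"
  define g where "g = (\<lambda>t. pi / 8 * \<bar>sin (real N * (t / 2)) / sin (t / 2)\<bar>)"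
  have cpos: "c k \<ge> 0" for k
  proof -
    have "1 \<le> (real (Suc k))\<^sup>2" by (rule one_le_power) simp
    then have "0 \<le> 4 * (real (Suc k))\<^sup>2 - 1" by linarith
    then show ?thesis unfolding c_def by (rule divide_nonneg_nonneg[OF zero_le_one])
  qed
  \<comment> \<open>Where \<open>sin (t / 2)\<close> is 0, all terms and \<open>g t\<close> are 0 by
    the convention on division, so the identity holds for every \<open>t\<close>.\<close>
  have sums: "(\<lambda>k. c k * ((sin (real (Suc k * N) * (t / 2)))\<^sup>2 / \<bar>sin (t / 2)\<bar>)) sums g t" for t
    using sums_divide[OF abs_sin_square_sums[of "real N * (t / 2)"], of "\<bar>sin (t / 2)\<bar>"]
    by (simp only: c_def g_def abs_divide of_nat_mult mult.assoc times_divide_eq_left times_divide_eq_right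
          divide_divide_eq_left mult_1_left)
  have int: "(f K has_integral (\<Sum>k<K. c k * (4 * odd_harm (Suc k * N)))) {-pi..pi}" for K
    unfolding f_def by (intro has_integral_sum has_integral_mult_right has_integral_sin_square_kernel) auto
  have "(\<lambda>K. integral {-pi..pi} (f K)) \<longlonglongrightarrow> integral {-pi..pi} g"
  proof (rule dominated_convergence(2))
    show "f K integrable_on {-pi..pi}" for K using int by blast
    show "g integrable_on {-pi..pi}"
      unfolding g_def by (intro integrable_on_mult_right integrable_lebesgue_kernel)
    show "(\<lambda>K. f K t) \<longlonglongrightarrow> g t" for t
      using sums[of t] unfolding sums_def f_def .
    show "norm (f K t) \<le> g t" for K t
    proof -
      have "f K t \<ge> 0" unfolding f_def by (intro sum_nonneg mult_nonneg_nonneg cpos) auto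
      moreover have "f K t \<le> g t" unfolding f_def sums_unique[OF sums]
        by (intro sum_le_suminf sums_summable[OF sums] mult_nonneg_nonneg cpos) auto
      ultimately show ?thesis by simp
    qed
  qed
  then have "(\<lambda>k. c k * (4 * odd_harm (Suc k * N))) sums integral {-pi..pi} g"
    unfolding sums_def integral_unique[OF int] .
  also have "integral {-pi..pi} g = pi / 8 * integral {-pi..pi} (\<lambda>t. \<bar>sin (real N * (t / 2)) / sin (t / 2)\<bar>)"
    unfolding g_def by (rule integral_mult_right)
  also have "integral {-pi..pi} (\<lambda>t. \<bar>sin (real N * (t / 2)) / sin (t / 2)\<bar>) = 2 * pi * lebesgue_const (real n / 2)"
    unfolding lebesgue_const_half N_def by (simp add: add.commute)
  finally have "(\<lambda>k. 4 * (c k * odd_harm (Suc k * N)) / 4) sums (pi / 8 * (2 * pi * lebesgue_const (real n / 2)) / 4)"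
    unfolding mult.left_commute[of _ 4] by (rule sums_divide)
  then have "(\<lambda>k. c k * odd_harm (Suc k * N)) sums (pi\<^sup>2 / 16 * lebesgue_const (real n / 2))"
    by (simp add: power2_eq_square mult.assoc)
  then show ?thesis
    unfolding c_def N_def by simp
qed

subsection \<open>Even zeta values\<close>

text \<open>A summable majorant of the derivatives allows termwise differentiation, so the sum and
  \<open>Q\<close> have the same derivative \<open>P\<close> on the convex set \<open>S\<close>; the
  anchor \<open>a\<close> fixes the constant between them.\<close>

lemma sums_antiderivative:
  fixes f :: "nat \<Rightarrow> real \<Rightarrow> real"
  assumes "convex S"
    and f: "\<And>k x. x \<in> S \<Longrightarrow> (f k has_real_derivative f' k x) (at x within S)"
    and bound: "\<And>k x. x \<in> S \<Longrightarrow> \<bar>f' k x\<bar> \<le> M k" "summable M"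
    and P: "\<And>x. x \<in> S \<Longrightarrow> (\<lambda>k. f' k x) sums P x"
    and Q: "\<And>x. x \<in> S \<Longrightarrow> (Q has_real_derivative P x) (at x within S)"
    and a: "a \<in> S" "(\<lambda>k. f k a) sums Q a"
    and x: "x \<in> S"
  shows "(\<lambda>k. f k x) sums Q x"
proof -
  have "uniform_limit S (\<lambda>n x. \<Sum>k<n. f' k x) (\<lambda>x. suminf (\<lambda>k. f' k x)) sequentially"
    using bound by (intro Weierstrass_m_test[where M = M]) auto
  also have "?this \<longleftrightarrow> uniform_limit S (\<lambda>n x. \<Sum>k<n. f' k x) P sequentially"
    using P by (intro uniform_limit_cong') (auto simp: sums_iff)
  finally have "uniform_limit S (\<lambda>n x. \<Sum>k<n. f' k x) P sequentially" .
  from has_field_derivative_series[OF assms(1) f this a(1) sums_summable[OF a(2)]]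
  obtain g where g: "\<And>x. x \<in> S \<Longrightarrow> (\<lambda>k. f k x) sums g x"
      "\<And>x. x \<in> S \<Longrightarrow> (g has_real_derivative P x) (at x within S)"
    by blast
  have "\<exists>c. \<forall>x\<in>S. g x - Q x = c"
  proof (rule has_field_derivative_zero_constant[OF assms(1)])
    fix x assume "x \<in> S"
    from DERIV_diff[OF g(2)[OF this] Q[OF this]]
    show "((\<lambda>x. g x - Q x) has_real_derivative 0) (at x within S)" by simp
  qed
  moreover have "g a = Q a"
    using sums_unique2[OF g(1)[OF a(1)] a(2)] .
  ultimately have "g x = Q x" using x a(1) by (metis diff_self eq_iff_diff_eq_0)
  then show ?thesis using g(1)[OF x] by simp
qed

lemma summable_inverse_odd_power:
  assumes "m \<ge> 2"
  shows "summable (\<lambda>k. 1 / (2 * real k + 1) ^ m)"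
proof (rule summable_comparison_test')
  show "summable (\<lambda>k. inverse (real (Suc k) ^ m))"
    using inverse_power_summable[OF assms, where 'a = real] by (subst summable_Suc_iff) simp
  fix k :: nat
  have "real (Suc k) ^ m \<le> (2 * real k + 1) ^ m" by (intro power_mono) auto
  then show "norm (1 / (2 * real k + 1) ^ m) \<le> inverse (real (Suc k) ^ m)"
    by (simp add: inverse_eq_divide) (intro divide_left_mono, auto)
qed

text \<open>This first integration is beyond \<open>sums_antiderivative\<close>: the differentiated
  series is the square wave, which has no summable majorant. For \<open>x > 0\<close> the uniform
  bound on \<open>{x..pi/2}\<close> is integrated from \<open>pi / 2\<close>, where all cosines
  vanish; the endpoint 0 follows by continuity.\<close>

lemma sums_cos_odd_square:
  assumes "x \<in> {0..pi/2}"
  shows "(\<lambda>k. cos ((2 * real k + 1) * x) / (2 * real k + 1)^2) sums (pi / 4 * (pi / 2 - x))"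
proof -
  define S where "S = (\<lambda>K x. \<Sum>k<K. cos ((2 * real k + 1) * x) / (2 * real k + 1)^2)"
  have pos: "(\<lambda>K. S K x) \<longlonglongrightarrow> pi / 4 * (pi / 2 - x)" if x: "0 < x" "x \<le> pi / 2" for x
  proof -
    define D where "D = (\<lambda>K x. S K x - pi / 4 * (pi / 2 - x))"
    have sx: "sin x > 0" using x by (intro sin_gt_zero) auto
    \<comment> \<open>A bound for the distance of the square wave from \<open>pi / 4\<close> that is
      uniform on \<open>{x..pi/2}\<close>: the oscillation relative to \<open>pi / 2\<close>, plus
      the error at \<open>pi / 2\<close> itself.\<close>
    define \<epsilon> where "\<epsilon> = (\<lambda>K. 1 / (real K * (sin x)\<^sup>2) + \<bar>square_wave K (pi / 2) - pi / 4\<bar>)"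
    have bnd: "\<bar>D K x\<bar> \<le> \<epsilon> K * (pi / 2 - x)" if K: "K > 0" for K
    proof -
      have der: "(D K has_real_derivative pi / 4 - square_wave K t) (at t)" for t
      proof -
        have "((\<lambda>t. S K t) has_real_derivative (\<Sum>k<K. - (sin ((2 * real k + 1) * t) / (2 * real k + 1)))) (at t)"
          unfolding S_def
        proof (rule DERIV_sum)
          fix k
          have nz: "2 * real k + 1 \<noteq> 0" by linarith
          have "((\<lambda>x. cos ((2 * real k + 1) * x) / (2 * real k + 1)\<^sup>2) has_real_derivative
                  - sin ((2 * real k + 1) * t) * (2 * real k + 1) / (2 * real k + 1)\<^sup>2) (at t)"
            by (intro DERIV_cdivide) (auto intro!: derivative_eq_intros)
          then show "((\<lambda>x. cos ((2 * real k + 1) * x) / (2 * real k + 1)\<^sup>2) has_real_derivative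
                  - (sin ((2 * real k + 1) * t) / (2 * real k + 1))) (at t)"
            using nz by (simp add: power2_eq_square)
        qed
        then show ?thesis
          unfolding D_def square_wave_def sum_negf
          by (auto intro!: derivative_eq_intros)
      qed
      have "norm (D K (pi/2) - D K x) \<le> \<epsilon> K * norm (pi/2 - x)"
      proof (rule field_differentiable_bound[of "{x..pi/2}" _ "\<lambda>t. pi / 4 - square_wave K t"])
        fix t assume t: "t \<in> {x..pi/2}"
        show "(D K has_real_derivative pi / 4 - square_wave K t) (at t within {x..pi/2})"
          using der by (rule has_field_derivative_at_within)
        have st: "sin x \<le> sin t" using t x by (intro sin_monotone_2pi_le) auto
        have "\<bar>square_wave K t - square_wave K (pi / 2)\<bar> \<le> 1 / (real K * (sin t)\<^sup>2)"
          using t x K by (intro square_wave_diff_bound) auto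
        also have "\<dots> \<le> 1 / (real K * (sin x)\<^sup>2)"
          using st sx K by (intro divide_left_mono mult_left_mono power_mono mult_pos_pos) auto
        finally show "norm (pi / 4 - square_wave K t) \<le> \<epsilon> K"
          unfolding \<epsilon>_def by simp
      qed (use x in auto)
      moreover have "D K (pi / 2) = 0"
        unfolding D_def S_def cos_odd_mult_half_pi by simp
      ultimately show ?thesis using x by simp
    qed
    have "\<epsilon> \<longlonglongrightarrow> 1 / (sin x)\<^sup>2 * 0 + \<bar>pi / 4 - pi / 4\<bar>"
    proof -
      have "(\<lambda>K. 1 / (sin x)\<^sup>2 * (1 / real K) + \<bar>square_wave K (pi / 2) - pi / 4\<bar>) \<longlonglongrightarrow> 1 / (sin x)\<^sup>2 * 0 + \<bar>pi / 4 - pi / 4\<bar>"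
        by (intro tendsto_intros lim_1_over_n square_wave_half_pi_tendsto)
      then show ?thesis by (simp add: \<epsilon>_def[abs_def] mult.commute)
    qed
    then have lim: "(\<lambda>K. \<epsilon> K * (pi / 2 - x)) \<longlonglongrightarrow> 0"
      using tendsto_mult_left_zero by simp
    have "(\<lambda>K. D K x) \<longlonglongrightarrow> 0"
      by (rule Lim_null_comparison[OF _ lim])
        (use eventually_gt_at_top[of 0] in eventually_elim, use bnd in simp)
    then show ?thesis unfolding D_def by (rule LIM_zero_cancel)
  qed
  \<comment> \<open>The cosine series has the majorant \<open>1 / (2 k + 1)^2\<close>, so its sum
    \<open>g\<close> is continuous and the formula extends to \<open>x = 0\<close>, the point that
    yields the sums of inverse powers.\<close>
  define g where "g = (\<lambda>x. suminf (\<lambda>k. cos ((2 * real k + 1) * x) / (2 * real k + 1)^2))"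
  have summ: "summable (\<lambda>k. cos ((2 * real k + 1) * x) / (2 * real k + 1)^2)" for x
    by (rule summable_comparison_test'[OF summable_inverse_odd_power[of 2]])
      (auto simp: divide_right_mono)
  have "uniform_limit UNIV S g sequentially"
    unfolding S_def g_def
    by (rule Weierstrass_m_test[OF _ summable_inverse_odd_power[of 2]]) (auto simp: divide_right_mono)
  then have "continuous_on UNIV g"
  proof (rule uniform_limit_theorem[rotated])
    show "\<forall>\<^sub>F K in sequentially. continuous_on UNIV (S K)"
      unfolding S_def by (intro always_eventually allI continuous_intros) auto
  qed simp
  then have "continuous_on (closure {0<..pi/2}) g"
    by (rule continuous_on_subset) simp
  then have "continuous_on (closure {0<..pi/2}) (\<lambda>x. g x - pi / 4 * (pi / 2 - x))"
    by (intro continuous_intros)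
  moreover have "g x - pi / 4 * (pi / 2 - x) = 0" if "x \<in> {0<..pi/2}" for x
  proof -
    have "(\<lambda>k. cos ((2 * real k + 1) * x) / (2 * real k + 1)^2) sums (pi / 4 * (pi / 2 - x))"
      using pos[of x] that unfolding sums_def S_def by auto
    then show ?thesis by (simp add: g_def sums_unique[symmetric])
  qed
  moreover have "x \<in> closure {0<..pi/2}" using assms by simp
  ultimately have "g x - pi / 4 * (pi / 2 - x) = 0"
    by (rule continuous_constant_on_closure)
  then have "g x = pi / 4 * (pi / 2 - x)"
    by (simp only: right_minus_eq)
  then show ?thesis
    using summable_sums[OF summ[of x]] unfolding g_def by metis
qed

text \<open>Sines vanish at 0, so integrating from there fixes the constant as
  \<open>Q 0 = 0\<close>. Keeping \<open>n\<close> separate from \<open>Suc m\<close> lets the rule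
  match numeral exponents.\<close>

lemma sums_sin_odd_step:
  assumes P: "\<And>x. x \<in> {0..pi/2} \<Longrightarrow> (\<lambda>k. cos ((2 * real k + 1) * x) / (2 * real k + 1) ^ m) sums P x"
    and Q: "\<And>x. (Q has_real_derivative P x) (at x)" "Q 0 = 0"
    and m: "m \<ge> 2" "n = Suc m" and x: "x \<in> {0..pi/2}"
  shows "(\<lambda>k. sin ((2 * real k + 1) * x) / (2 * real k + 1) ^ n) sums Q x"
  unfolding m(2)
proof -
  have nz: "2 * real k + 1 \<noteq> 0" for k by linarith
  have "((\<lambda>x. sin ((2 * real k + 1) * x) / (2 * real k + 1) ^ Suc m) has_real_derivative
          cos ((2 * real k + 1) * x) * (2 * real k + 1) / (2 * real k + 1) ^ Suc m) (at x)" for k x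
    by (intro DERIV_cdivide) (auto intro!: derivative_eq_intros)
  then have "((\<lambda>x. sin ((2 * real k + 1) * x) / (2 * real k + 1) ^ Suc m) has_real_derivative
          cos ((2 * real k + 1) * x) / (2 * real k + 1) ^ m) (at x)" for k x
    using nz by simp
  then have d: "((\<lambda>x. sin ((2 * real k + 1) * x) / (2 * real k + 1) ^ Suc m) has_real_derivative
          cos ((2 * real k + 1) * x) / (2 * real k + 1) ^ m) (at x within {0..pi/2})" for k x
    by (rule has_field_derivative_at_within)
  have b: "\<bar>cos ((2 * real k + 1) * x) / (2 * real k + 1) ^ m\<bar> \<le> 1 / (2 * real k + 1) ^ m" for k x
    by (simp add: divide_right_mono)
  have q: "(Q has_real_derivative P x) (at x within {0..pi/2})" for x
    using Q(1) by (rule has_field_derivative_at_within)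
  have z: "(\<lambda>k. sin ((2 * real k + 1) * 0) / (2 * real k + 1) ^ Suc m) sums Q 0"
    by (simp add: Q(2))
  show "(\<lambda>k. sin ((2 * real k + 1) * x) / (2 * real k + 1) ^ Suc m) sums Q x"
    by (rule sums_antiderivative[where S = "{0..pi/2}" and P = "P" and a = "0"
          and f = "\<lambda>k x. sin ((2 * real k + 1) * x) / (2 * real k + 1) ^ Suc m"
          and f' = "\<lambda>k x. cos ((2 * real k + 1) * x) / (2 * real k + 1) ^ m",
          OF _ d b summable_inverse_odd_power[OF m(1)] P q _ z x]) auto
qed

text \<open>The counterpart of \<open>sums_sin_odd_step\<close> with the anchor at
  \<open>pi / 2\<close>, where cosines of odd multiples vanish. The condition there determines the
  constant term of \<open>Q\<close>, which is the sum of inverse odd powers wanted at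
  \<open>x = 0\<close>.\<close>

lemma sums_cos_odd_step:
  assumes P: "\<And>x. x \<in> {0..pi/2} \<Longrightarrow> (\<lambda>k. sin ((2 * real k + 1) * x) / (2 * real k + 1) ^ m) sums P x"
    and Q: "\<And>x. (Q has_real_derivative - P x) (at x)" "Q (pi / 2) = 0"
    and m: "m \<ge> 2" "n = Suc m" and x: "x \<in> {0..pi/2}"
  shows "(\<lambda>k. cos ((2 * real k + 1) * x) / (2 * real k + 1) ^ n) sums Q x"
  unfolding m(2)
proof -
  have nz: "2 * real k + 1 \<noteq> 0" for k by linarith
  have "((\<lambda>x. cos ((2 * real k + 1) * x) / (2 * real k + 1) ^ Suc m) has_real_derivative
          - sin ((2 * real k + 1) * x) * (2 * real k + 1) / (2 * real k + 1) ^ Suc m) (at x)" for k x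
    by (intro DERIV_cdivide) (auto intro!: derivative_eq_intros)
  then have "((\<lambda>x. cos ((2 * real k + 1) * x) / (2 * real k + 1) ^ Suc m) has_real_derivative
          - (sin ((2 * real k + 1) * x) / (2 * real k + 1) ^ m)) (at x)" for k x
    using nz by simp
  then have d: "((\<lambda>x. cos ((2 * real k + 1) * x) / (2 * real k + 1) ^ Suc m) has_real_derivative
          - (sin ((2 * real k + 1) * x) / (2 * real k + 1) ^ m)) (at x within {0..pi/2})" for k x
    by (rule has_field_derivative_at_within)
  have b: "\<bar>- (sin ((2 * real k + 1) * x) / (2 * real k + 1) ^ m)\<bar> \<le> 1 / (2 * real k + 1) ^ m" for k x
    by (simp add: divide_right_mono)
  have p: "(\<lambda>k. - (sin ((2 * real k + 1) * x) / (2 * real k + 1) ^ m)) sums - P x" if "x \<in> {0..pi/2}" for x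
    using P[OF that] by (rule sums_minus)
  have q: "(Q has_real_derivative - P x) (at x within {0..pi/2})" for x
    using Q(1) by (rule has_field_derivative_at_within)
  have z: "(\<lambda>k. cos ((2 * real k + 1) * (pi / 2)) / (2 * real k + 1) ^ Suc m) sums Q (pi / 2)"
    by (simp add: Q(2) cos_odd_mult_half_pi del: times_divide_eq_right)
  show "(\<lambda>k. cos ((2 * real k + 1) * x) / (2 * real k + 1) ^ Suc m) sums Q x"
    by (rule sums_antiderivative[where S = "{0..pi/2}" and P = "\<lambda>x. - P x" and a = "pi / 2"
          and f = "\<lambda>k x. cos ((2 * real k + 1) * x) / (2 * real k + 1) ^ Suc m"
          and f' = "\<lambda>k x. - (sin ((2 * real k + 1) * x) / (2 * real k + 1) ^ m)",
          OF _ d b summable_inverse_odd_power[OF m(1)] p q _ z x]) auto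
qed

lemma odd_inverse_power_sums:
  shows "(\<lambda>k. 1 / (2 * real k + 1) ^ 2) sums (1/8 * pi ^ 2)"
    "(\<lambda>k. 1 / (2 * real k + 1) ^ 4) sums (1/96 * pi ^ 4)"
    "(\<lambda>k. 1 / (2 * real k + 1) ^ 6) sums (1/960 * pi ^ 6)"
    "(\<lambda>k. 1 / (2 * real k + 1) ^ 8) sums (17/161280 * pi ^ 8)"
    "(\<lambda>k. 1 / (2 * real k + 1) ^ 10) sums (31/2903040 * pi ^ 10)"
proof -
  have S2: "(\<lambda>k. cos ((2 * real k + 1) * x) / (2 * real k + 1) ^ 2) sums (- 1/4 * pi * x + 1/8 * pi^2)"
    if "x \<in> {0..pi/2}" for x
    using sums_cos_odd_square[OF that] by (simp add: algebra_simps power2_eq_square)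
  have S3: "(\<lambda>k. sin ((2 * real k + 1) * x) / (2 * real k + 1) ^ 3) sums (- 1/8 * pi * x^2 + 1/8 * pi^2 * x)"
    if "x \<in> {0..pi/2}" for x
  proof (rule sums_sin_odd_step[OF S2, where Q = "\<lambda>x. - 1/8 * pi * x^2 + 1/8 * pi^2 * x"])
    show "((\<lambda>x. - 1/8 * pi * x^2 + 1/8 * pi^2 * x) has_real_derivative - 1/4 * pi * x + 1/8 * pi^2) (at x)" for x
      by (rule DERIV_cong, (rule DERIV_add DERIV_diff DERIV_cmult DERIV_pow DERIV_const DERIV_ident)+) (simp add: mult_ac)
  qed (use that in auto)
  have S4: "(\<lambda>k. cos ((2 * real k + 1) * x) / (2 * real k + 1) ^ 4) sums (1/24 * pi * x^3 - 1/16 * pi^2 * x^2 + 1/96 * pi^4)"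
    if "x \<in> {0..pi/2}" for x
  proof (rule sums_cos_odd_step[OF S3, where Q = "\<lambda>x. 1/24 * pi * x^3 - 1/16 * pi^2 * x^2 + 1/96 * pi^4"])
    show "((\<lambda>x. 1/24 * pi * x^3 - 1/16 * pi^2 * x^2 + 1/96 * pi^4) has_real_derivative - (- 1/8 * pi * x^2 + 1/8 * pi^2 * x)) (at x)" for x
      by (rule DERIV_cong, (rule DERIV_add DERIV_diff DERIV_cmult DERIV_pow DERIV_const DERIV_ident)+) (simp add: mult_ac)
    \<comment> \<open>With \<open>y = pi / 2\<close> and pi written as \<open>2 * y\<close>, the
      anchor condition is a polynomial identity in one variable.\<close>
    have "1/24 * (2 * y) * y^3 - 1/16 * (2 * y)^2 * y^2 + 1/96 * (2 * y)^4 = 0" for y :: real by algebra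
    from this[of "pi / 2"] show "1/24 * pi * (pi / 2)^3 - 1/16 * pi^2 * (pi / 2)^2 + 1/96 * pi^4 = 0" by simp
  qed (use that in auto)
  have S5: "(\<lambda>k. sin ((2 * real k + 1) * x) / (2 * real k + 1) ^ 5) sums (1/96 * pi * x^4 - 1/48 * pi^2 * x^3 + 1/96 * pi^4 * x)"
    if "x \<in> {0..pi/2}" for x
  proof (rule sums_sin_odd_step[OF S4, where Q = "\<lambda>x. 1/96 * pi * x^4 - 1/48 * pi^2 * x^3 + 1/96 * pi^4 * x"])
    show "((\<lambda>x. 1/96 * pi * x^4 - 1/48 * pi^2 * x^3 + 1/96 * pi^4 * x) has_real_derivative 1/24 * pi * x^3 - 1/16 * pi^2 * x^2 + 1/96 * pi^4) (at x)" for x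
      by (rule DERIV_cong, (rule DERIV_add DERIV_diff DERIV_cmult DERIV_pow DERIV_const DERIV_ident)+) (simp add: mult_ac)
  qed (use that in auto)
  have S6: "(\<lambda>k. cos ((2 * real k + 1) * x) / (2 * real k + 1) ^ 6) sums (- 1/480 * pi * x^5 + 1/192 * pi^2 * x^4 - 1/192 * pi^4 * x^2 + 1/960 * pi^6)"
    if "x \<in> {0..pi/2}" for x
  proof (rule sums_cos_odd_step[OF S5, where Q = "\<lambda>x. - 1/480 * pi * x^5 + 1/192 * pi^2 * x^4 - 1/192 * pi^4 * x^2 + 1/960 * pi^6"])
    show "((\<lambda>x. - 1/480 * pi * x^5 + 1/192 * pi^2 * x^4 - 1/192 * pi^4 * x^2 + 1/960 * pi^6) has_real_derivative - (1/96 * pi * x^4 - 1/48 * pi^2 * x^3 + 1/96 * pi^4 * x)) (at x)" for x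
      by (rule DERIV_cong, (rule DERIV_add DERIV_diff DERIV_cmult DERIV_pow DERIV_const DERIV_ident)+) (simp add: mult_ac)
    have "- 1/480 * (2 * y) * y^5 + 1/192 * (2 * y)^2 * y^4 - 1/192 * (2 * y)^4 * y^2 + 1/960 * (2 * y)^6 = 0" for y :: real by algebra
    from this[of "pi / 2"] show "- 1/480 * pi * (pi / 2)^5 + 1/192 * pi^2 * (pi / 2)^4 - 1/192 * pi^4 * (pi / 2)^2 + 1/960 * pi^6 = 0" by simp
  qed (use that in auto)
  have S7: "(\<lambda>k. sin ((2 * real k + 1) * x) / (2 * real k + 1) ^ 7) sums (- 1/2880 * pi * x^6 + 1/960 * pi^2 * x^5 - 1/576 * pi^4 * x^3 + 1/960 * pi^6 * x)"
    if "x \<in> {0..pi/2}" for x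
  proof (rule sums_sin_odd_step[OF S6, where Q = "\<lambda>x. - 1/2880 * pi * x^6 + 1/960 * pi^2 * x^5 - 1/576 * pi^4 * x^3 + 1/960 * pi^6 * x"])
    show "((\<lambda>x. - 1/2880 * pi * x^6 + 1/960 * pi^2 * x^5 - 1/576 * pi^4 * x^3 + 1/960 * pi^6 * x) has_real_derivative - 1/480 * pi * x^5 + 1/192 * pi^2 * x^4 - 1/192 * pi^4 * x^2 + 1/960 * pi^6) (at x)" for x
      by (rule DERIV_cong, (rule DERIV_add DERIV_diff DERIV_cmult DERIV_pow DERIV_const DERIV_ident)+) (simp add: mult_ac)
  qed (use that in auto)
  have S8: "(\<lambda>k. cos ((2 * real k + 1) * x) / (2 * real k + 1) ^ 8) sums (1/20160 * pi * x^7 - 1/5760 * pi^2 * x^6 + 1/2304 * pi^4 * x^4 - 1/1920 * pi^6 * x^2 + 17/161280 * pi^8)"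
    if "x \<in> {0..pi/2}" for x
  proof (rule sums_cos_odd_step[OF S7, where Q = "\<lambda>x. 1/20160 * pi * x^7 - 1/5760 * pi^2 * x^6 + 1/2304 * pi^4 * x^4 - 1/1920 * pi^6 * x^2 + 17/161280 * pi^8"])
    show "((\<lambda>x. 1/20160 * pi * x^7 - 1/5760 * pi^2 * x^6 + 1/2304 * pi^4 * x^4 - 1/1920 * pi^6 * x^2 + 17/161280 * pi^8) has_real_derivative - (- 1/2880 * pi * x^6 + 1/960 * pi^2 * x^5 - 1/576 * pi^4 * x^3 + 1/960 * pi^6 * x)) (at x)" for x
      by (rule DERIV_cong, (rule DERIV_add DERIV_diff DERIV_cmult DERIV_pow DERIV_const DERIV_ident)+) (simp add: mult_ac)
    have "1/20160 * (2 * y) * y^7 - 1/5760 * (2 * y)^2 * y^6 + 1/2304 * (2 * y)^4 * y^4 - 1/1920 * (2 * y)^6 * y^2 + 17/161280 * (2 * y)^8 = 0" for y :: real by algebra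
    from this[of "pi / 2"] show "1/20160 * pi * (pi / 2)^7 - 1/5760 * pi^2 * (pi / 2)^6 + 1/2304 * pi^4 * (pi / 2)^4 - 1/1920 * pi^6 * (pi / 2)^2 + 17/161280 * pi^8 = 0" by simp
  qed (use that in auto)
  have S9: "(\<lambda>k. sin ((2 * real k + 1) * x) / (2 * real k + 1) ^ 9) sums (1/161280 * pi * x^8 - 1/40320 * pi^2 * x^7 + 1/11520 * pi^4 * x^5 - 1/5760 * pi^6 * x^3 + 17/161280 * pi^8 * x)"
    if "x \<in> {0..pi/2}" for x
  proof (rule sums_sin_odd_step[OF S8, where Q = "\<lambda>x. 1/161280 * pi * x^8 - 1/40320 * pi^2 * x^7 + 1/11520 * pi^4 * x^5 - 1/5760 * pi^6 * x^3 + 17/161280 * pi^8 * x"])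
    show "((\<lambda>x. 1/161280 * pi * x^8 - 1/40320 * pi^2 * x^7 + 1/11520 * pi^4 * x^5 - 1/5760 * pi^6 * x^3 + 17/161280 * pi^8 * x) has_real_derivative 1/20160 * pi * x^7 - 1/5760 * pi^2 * x^6 + 1/2304 * pi^4 * x^4 - 1/1920 * pi^6 * x^2 + 17/161280 * pi^8) (at x)" for x
      by (rule DERIV_cong, (rule DERIV_add DERIV_diff DERIV_cmult DERIV_pow DERIV_const DERIV_ident)+) (simp add: mult_ac)
  qed (use that in auto)
  have S10: "(\<lambda>k. cos ((2 * real k + 1) * x) / (2 * real k + 1) ^ 10) sums (- 1/1451520 * pi * x^9 + 1/322560 * pi^2 * x^8 - 1/69120 * pi^4 * x^6 + 1/23040 * pi^6 * x^4 - 17/322560 * pi^8 * x^2 + 31/2903040 * pi^10)"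
    if "x \<in> {0..pi/2}" for x
  proof (rule sums_cos_odd_step[OF S9, where Q = "\<lambda>x. - 1/1451520 * pi * x^9 + 1/322560 * pi^2 * x^8 - 1/69120 * pi^4 * x^6 + 1/23040 * pi^6 * x^4 - 17/322560 * pi^8 * x^2 + 31/2903040 * pi^10"])
    show "((\<lambda>x. - 1/1451520 * pi * x^9 + 1/322560 * pi^2 * x^8 - 1/69120 * pi^4 * x^6 + 1/23040 * pi^6 * x^4 - 17/322560 * pi^8 * x^2 + 31/2903040 * pi^10) has_real_derivative - (1/161280 * pi * x^8 - 1/40320 * pi^2 * x^7 + 1/11520 * pi^4 * x^5 - 1/5760 * pi^6 * x^3 + 17/161280 * pi^8 * x)) (at x)" for x
      by (rule DERIV_cong, (rule DERIV_add DERIV_diff DERIV_cmult DERIV_pow DERIV_const DERIV_ident)+) (simp add: mult_ac)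
    have "- 1/1451520 * (2 * y) * y^9 + 1/322560 * (2 * y)^2 * y^8 - 1/69120 * (2 * y)^4 * y^6 + 1/23040 * (2 * y)^6 * y^4 - 17/322560 * (2 * y)^8 * y^2 + 31/2903040 * (2 * y)^10 = 0" for y :: real by algebra
    from this[of "pi / 2"] show "- 1/1451520 * pi * (pi / 2)^9 + 1/322560 * pi^2 * (pi / 2)^8 - 1/69120 * pi^4 * (pi / 2)^6 + 1/23040 * pi^6 * (pi / 2)^4 - 17/322560 * pi^8 * (pi / 2)^2 + 31/2903040 * pi^10 = 0" by simp
  qed (use that in auto)
  show "(\<lambda>k. 1 / (2 * real k + 1) ^ 2) sums (1/8 * pi ^ 2)"
    using S2[of 0] by simp
  show "(\<lambda>k. 1 / (2 * real k + 1) ^ 4) sums (1/96 * pi ^ 4)"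
    using S4[of 0] by simp
  show "(\<lambda>k. 1 / (2 * real k + 1) ^ 6) sums (1/960 * pi ^ 6)"
    using S6[of 0] by simp
  show "(\<lambda>k. 1 / (2 * real k + 1) ^ 8) sums (17/161280 * pi ^ 8)"
    using S8[of 0] by simp
  show "(\<lambda>k. 1 / (2 * real k + 1) ^ 10) sums (31/2903040 * pi ^ 10)"
    using S10[of 0] by simp
qed

text \<open>Grouping the terms in pairs separates odd from even bases, and the even ones reproduce
  the whole sum: \<open>Z = L + Z / 2 ^ m\<close>.\<close>

lemma inverse_power_sums_of_odd:
  assumes L: "(\<lambda>k. 1 / (2 * real k + 1) ^ m) sums L" and m: "m \<ge> 2"
  shows "(\<lambda>k. 1 / real (Suc k) ^ m) sums (2 ^ m / (2 ^ m - 1) * L)"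
proof -
  have "summable (\<lambda>k. inverse (real (Suc k) ^ m))"
    using inverse_power_summable[OF m, where 'a = real] by (subst summable_Suc_iff) simp
  then obtain Z where Z: "(\<lambda>k. 1 / real (Suc k) ^ m) sums Z"
    by (auto simp: summable_def inverse_eq_divide)
  have "(\<lambda>k. \<Sum>i\<in>{k * 2..<k * 2 + 2}. 1 / real (Suc i) ^ m) sums Z"
    using Z by (rule sums_group) simp
  moreover have "(\<Sum>i\<in>{k * 2..<k * 2 + 2}. 1 / real (Suc i) ^ m)
      = 1 / (2 * real k + 1) ^ m + (1 / 2 ^ m) * (1 / real (Suc k) ^ m)" for k
  proof -
    have s: "(\<Sum>i\<in>{k * 2..<k * 2 + 2}. 1 / real (Suc i) ^ m)
        = 1 / real (Suc (k * 2)) ^ m + 1 / real (Suc (k * 2 + 1)) ^ m"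
      by simp
    have e: "real (Suc (k * 2 + 1)) = 2 * real (Suc k)" "real (Suc (k * 2)) = 2 * real k + 1"
      by simp_all
    show ?thesis unfolding s e power_mult_distrib by simp
  qed
  ultimately have "(\<lambda>k. 1 / (2 * real k + 1) ^ m + (1 / 2 ^ m) * (1 / real (Suc k) ^ m)) sums Z"
    by simp
  moreover have "(\<lambda>k. 1 / (2 * real k + 1) ^ m + (1 / 2 ^ m) * (1 / real (Suc k) ^ m)) sums (L + (1 / 2 ^ m) * Z)"
    by (intro sums_add sums_mult L Z)
  ultimately have eq: "Z = L + (1 / 2 ^ m) * Z" by (rule sums_unique2)
  have "(2::real) ^ m > 1" using m by (intro one_less_power) auto
  with eq have "Z = 2 ^ m / (2 ^ m - 1) * L" by (simp add: field_simps)
  with Z show ?thesis by simp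
qed

lemma inverse_even_power_sums:
  shows "(\<lambda>k. 1 / real (Suc k) ^ 2) sums (pi ^ 2 / 6)"
    and "(\<lambda>k. 1 / real (Suc k) ^ 4) sums (pi ^ 4 / 90)"
    and "(\<lambda>k. 1 / real (Suc k) ^ 6) sums (pi ^ 6 / 945)"
    and "(\<lambda>k. 1 / real (Suc k) ^ 8) sums (pi ^ 8 / 9450)"
    and "(\<lambda>k. 1 / real (Suc k) ^ 10) sums (pi ^ 10 / 93555)"
  using odd_inverse_power_sums[THEN inverse_power_sums_of_odd] by simp_all

section \<open>Even zeta sums weighted by \<open>1 / (4 k^2 - 1)\<close>\<close>

lemma four_square_minus_one_pos: "4 * real (Suc k)^2 - 1 > 0"
proof -
  have "1 \<le> (real (Suc k))\<^sup>2" by (rule one_le_power) simp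
  then show ?thesis by linarith
qed

lemma weighted_zeta_0: "(\<lambda>k. 1 / real (Suc k) ^ 0 * (1 / (4 * real (Suc k)^2 - 1))) sums (1 / 2)"
proof -
  define u where "u = (\<lambda>k. 1 / (2 * (2 * real k + 1)))"
  have "u \<longlonglongrightarrow> 0" unfolding u_def by real_asymp
  from telescope_sums'[OF this] have "(\<lambda>k. u k - u (Suc k)) sums (1 / 2)"
    by (simp add: u_def)
  moreover have "u k - u (Suc k) = 1 / real (Suc k) ^ 0 * (1 / (4 * real (Suc k)^2 - 1))" for k
  proof -
    have "4 * real (Suc k)^2 - 1 = (2 * real k + 1) * (2 * real k + 3)"
      by (simp add: power2_eq_square algebra_simps)
    then show ?thesis
      unfolding u_def by (simp only:) (simp add: divide_simps, simp add: algebra_simps)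
  qed
  ultimately show ?thesis by simp
qed

text \<open>Partial fractions: \<open>1 / (k ^ (m + 2) * (4 k^2 - 1)) = 4 / (k ^ m * (4 k^2 - 1)) -
  1 / k ^ (m + 2)\<close>. Each use lowers the weighted sum to the previous one and an even zeta
  value, down to the telescoping \<open>weighted_zeta_0\<close>.\<close>

lemma weighted_zeta_step:
  assumes "(\<lambda>k. 1 / real (Suc k) ^ m * (1 / (4 * real (Suc k)^2 - 1))) sums T"
    and "(\<lambda>k. 1 / real (Suc k) ^ n) sums Z" and n: "n = m + 2"
  shows "(\<lambda>k. 1 / real (Suc k) ^ n * (1 / (4 * real (Suc k)^2 - 1))) sums (4 * T - Z)"
proof -
  have "4 * (1 / real (Suc k) ^ m * (1 / (4 * real (Suc k)^2 - 1))) - 1 / real (Suc k) ^ n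
     = 1 / real (Suc k) ^ n * (1 / (4 * real (Suc k)^2 - 1))" for k
  proof -
    define x where "x = real (Suc k)"
    define w where "w = 4 * x\<^sup>2 - 1"
    have "x > 0" "w > 0"
      using four_square_minus_one_pos[of k] by (simp_all add: x_def w_def)
    then have "4 * (1 / x ^ m * (1 / w)) - 1 / (x ^ m * x\<^sup>2) = 1 / (x ^ m * x\<^sup>2) * (1 / w)"
      by (simp add: divide_simps) (simp add: w_def)
    then show ?thesis unfolding n power_add x_def w_def .
  qed
  with sums_diff[OF sums_mult[OF assms(1), of 4] assms(2)] show ?thesis
    by (simp only:)
qed

lemma weighted_zeta_sums:
  shows "(\<lambda>k. 1 / real (Suc k) ^ 2 * (1 / (4 * real (Suc k)^2 - 1))) sums (2 - pi^2 / 6)"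
    and "(\<lambda>k. 1 / real (Suc k) ^ 4 * (1 / (4 * real (Suc k)^2 - 1))) sums (8 - 2 * pi^2 / 3 - pi^4 / 90)"
    and "(\<lambda>k. 1 / real (Suc k) ^ 6 * (1 / (4 * real (Suc k)^2 - 1))) sums
           (32 - 8 * pi^2 / 3 - 2 * pi^4 / 45 - pi^6 / 945)"
    and "(\<lambda>k. 1 / real (Suc k) ^ 8 * (1 / (4 * real (Suc k)^2 - 1))) sums
           (128 - 32 * pi^2 / 3 - 8 * pi^4 / 45 - 4 * pi^6 / 945 - pi^8 / 9450)"
    and "(\<lambda>k. 1 / real (Suc k) ^ 10 * (1 / (4 * real (Suc k)^2 - 1))) sums
           (512 - 128 * pi^2 / 3 - 32 * pi^4 / 45 - 16 * pi^6 / 945 - 2 * pi^8 / 4725 - pi^10 / 93555)"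
proof -
  note T1 = weighted_zeta_step[OF weighted_zeta_0 inverse_even_power_sums(1)]
  note T2 = weighted_zeta_step[OF T1 inverse_even_power_sums(2)]
  note T3 = weighted_zeta_step[OF T2 inverse_even_power_sums(3)]
  note T4 = weighted_zeta_step[OF T3 inverse_even_power_sums(4)]
  note T5 = weighted_zeta_step[OF T4 inverse_even_power_sums(5)]
  have e: "4 * (1 / 2) - pi^2 / 6 = 2 - pi^2 / 6"
    "4 * (4 * (1 / 2) - pi^2 / 6) - pi^4 / 90 = 8 - 2 * pi^2 / 3 - pi^4 / 90"
    "4 * (4 * (4 * (1 / 2) - pi^2 / 6) - pi^4 / 90) - pi^6 / 945 = 32 - 8 * pi^2 / 3 - 2 * pi^4 / 45 - pi^6 / 945"
    "4 * (4 * (4 * (4 * (1 / 2) - pi^2 / 6) - pi^4 / 90) - pi^6 / 945) - pi^8 / 9450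
      = 128 - 32 * pi^2 / 3 - 8 * pi^4 / 45 - 4 * pi^6 / 945 - pi^8 / 9450"
    "4 * (4 * (4 * (4 * (4 * (1 / 2) - pi^2 / 6) - pi^4 / 90) - pi^6 / 945) - pi^8 / 9450) - pi^10 / 93555
      = 512 - 128 * pi^2 / 3 - 32 * pi^4 / 45 - 16 * pi^6 / 945 - 2 * pi^8 / 4725 - pi^10 / 93555"
    by simp_all
  show "(\<lambda>k. 1 / real (Suc k) ^ 2 * (1 / (4 * real (Suc k)^2 - 1))) sums (2 - pi^2 / 6)"
    unfolding e(1)[symmetric] by (rule T1) simp
  show "(\<lambda>k. 1 / real (Suc k) ^ 4 * (1 / (4 * real (Suc k)^2 - 1))) sums (8 - 2 * pi^2 / 3 - pi^4 / 90)"
    unfolding e(2)[symmetric] by (rule T2) simp_all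
  show "(\<lambda>k. 1 / real (Suc k) ^ 6 * (1 / (4 * real (Suc k)^2 - 1))) sums
           (32 - 8 * pi^2 / 3 - 2 * pi^4 / 45 - pi^6 / 945)"
    unfolding e(3)[symmetric] by (rule T3) simp_all
  show "(\<lambda>k. 1 / real (Suc k) ^ 8 * (1 / (4 * real (Suc k)^2 - 1))) sums
           (128 - 32 * pi^2 / 3 - 8 * pi^4 / 45 - 4 * pi^6 / 945 - pi^8 / 9450)"
    unfolding e(4)[symmetric] by (rule T4) simp_all
  show "(\<lambda>k. 1 / real (Suc k) ^ 10 * (1 / (4 * real (Suc k)^2 - 1))) sums
           (512 - 128 * pi^2 / 3 - 32 * pi^4 / 45 - 16 * pi^6 / 945 - 2 * pi^8 / 4725 - pi^10 / 93555)"
    unfolding e(5)[symmetric] by (rule T5) simp_all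
qed

subsection \<open>Asymptotic expansion of the Lebesgue constants\<close>

text \<open>The argument \<open>y\<close> is \<open>N^2\<close>. The coefficient of
  \<open>1 / y ^ j\<close> is that of \<open>odd_harm_tail\<close> divided by \<open>4 ^ j\<close>,
  since the argument there is \<open>2 k N\<close>, times the weighted sum with exponent
  \<open>2 j\<close>; the factor \<open>16 / pi^2\<close> is that of Szego's formula.\<close>

definition lebesgue_tail :: "real \<Rightarrow> real" where
  "lebesgue_tail y = 16 / pi^2 *
     (1/48 * (2 - pi^2 / 6) / y
      - 7/1920 * (8 - 2 * pi^2 / 3 - pi^4 / 90) / y^2
      + 31/16128 * (32 - 8 * pi^2 / 3 - 2 * pi^4 / 45 - pi^6 / 945) / y^3
      - 127/61440 * (128 - 32 * pi^2 / 3 - 8 * pi^4 / 45 - 4 * pi^6 / 945 - pi^8 / 9450) / y^4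
      + 511/135168 * (512 - 128 * pi^2 / 3 - 32 * pi^4 / 45 - 16 * pi^6 / 945 - 2 * pi^8 / 4725 - pi^10 / 93555) / y^5)"

lemma odd_harm_tail_sums:
  assumes N: "N > 0"
  shows "(\<lambda>k. odd_harm_tail (2 * real (Suc k * N)) * (1 / (4 * real (Suc k)^2 - 1)))
           sums (pi^2 / 16 * lebesgue_tail (real N ^ 2))"
proof -
  define y where "y = real N ^ 2"
  define w where "w = (\<lambda>k. 1 / (4 * real (Suc k)^2 - 1))"
  have cancel: "pi^2 / 16 * (16 / pi^2 * X) = X" for X by simp
  define g where "g = (\<lambda>m k. 1 / real (Suc k) ^ m * w k)"
  have "(\<lambda>k. (1/48) / y * g 2 k - (7/1920) / y^2 * g 4 k + (31/16128) / y^3 * g 6 k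
         - (127/61440) / y^4 * g 8 k + (511/135168) / y^5 * g 10 k) sums
      ((1/48) / y * (2 - pi^2 / 6)
      - (7/1920) / y^2 * (8 - 2 * pi^2 / 3 - pi^4 / 90)
      + (31/16128) / y^3 * (32 - 8 * pi^2 / 3 - 2 * pi^4 / 45 - pi^6 / 945)
      - (127/61440) / y^4 * (128 - 32 * pi^2 / 3 - 8 * pi^4 / 45 - 4 * pi^6 / 945 - pi^8 / 9450)
      + (511/135168) / y^5 * (512 - 128 * pi^2 / 3 - 32 * pi^4 / 45 - 16 * pi^6 / 945 - 2 * pi^8 / 4725 - pi^10 / 93555))"
    unfolding g_def w_def by (intro sums_add sums_diff sums_mult weighted_zeta_sums)
  also have "(\<lambda>k. (1/48) / y * g 2 k - (7/1920) / y^2 * g 4 k + (31/16128) / y^3 * g 6 k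
         - (127/61440) / y^4 * g 8 k + (511/135168) / y^5 * g 10 k)
     = (\<lambda>k. odd_harm_tail (2 * real (Suc k * N)) * w k)"
  proof
    fix k
    define z where "z = real (Suc k)"
    have p: "(1 / (2 * real (Suc k * N))) ^ (2 * i) = 1 / (4 ^ i * y ^ i * z ^ (2 * i))" for i
      unfolding of_nat_mult z_def[symmetric]
      by (simp add: y_def power_mult power_mult_distrib power_divide)
    have q: "(1 / (2 * real (Suc k * N))) ^ 2 = 1 / (4 * y * z ^ 2)"
      "(1 / (2 * real (Suc k * N))) ^ 4 = 1 / (16 * y ^ 2 * z ^ 4)"
      "(1 / (2 * real (Suc k * N))) ^ 6 = 1 / (64 * y ^ 3 * z ^ 6)"
      "(1 / (2 * real (Suc k * N))) ^ 8 = 1 / (256 * y ^ 4 * z ^ 8)"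
      "(1 / (2 * real (Suc k * N))) ^ 10 = 1 / (1024 * y ^ 5 * z ^ 10)"
      using p[of 1] p[of 2] p[of 3] p[of 4] p[of 5] by (simp_all del: of_nat_Suc of_nat_mult)
    show "(1/48) / y * g 2 k - (7/1920) / y^2 * g 4 k + (31/16128) / y^3 * g 6 k
         - (127/61440) / y^4 * g 8 k + (511/135168) / y^5 * g 10 k = odd_harm_tail (2 * real (Suc k * N)) * w k"
      unfolding odd_harm_tail_def q g_def z_def[symmetric]
      by (simp add: distrib_right left_diff_distrib)
  qed
  finally show ?thesis
    unfolding w_def lebesgue_tail_def y_def cancel by (simp only: times_divide_eq_left)
qed

text \<open>Inserting \<open>odd_harm_expansion\<close> at \<open>m = k N\<close> and splitting
  \<open>ln (k N)\<close> gives \<open>MC\<^sub>0\<close>: the part \<open>ln k\<close> produces the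
  series in \<open>c\<^sub>1\<close>, while \<open>ln N\<close> and the constants are multiplied by
  the total weight 1/2.\<close>

lemma lebesgue_const_expansion:
  obtains C where "C \<ge> 0"
    "\<And>n. \<bar>lebesgue_const (real n / 2) - MC\<^sub>0 n - lebesgue_tail ((real n + 1)^2)\<bar> \<le> C / (real n + 1) ^ 12"
proof -
  obtain C where C: "C \<ge> 0"
    "\<And>m. m > 0 \<Longrightarrow> \<bar>odd_harm m - (ln (real m) + euler_mascheroni + 2 * ln 2) / 2 - odd_harm_tail (2 * real m)\<bar>
        \<le> C / real m ^ 12"
    using odd_harm_expansion by blast
  define w where "w = (\<lambda>k. 1 / (4 * real (Suc k)^2 - 1))"
  define r where "r = (\<lambda>m. odd_harm m - (ln (real m) + euler_mascheroni + 2 * ln 2) / 2 - odd_harm_tail (2 * real m))"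
  have tail_w: "(\<lambda>k. odd_harm_tail (2 * real (Suc k * N)) * w k) sums (pi^2 / 16 * lebesgue_tail (real N ^ 2))"
    if "N > 0" for N
    unfolding w_def by (rule odd_harm_tail_sums[OF that])
  have wpos: "w k > 0" for k using four_square_minus_one_pos[of k] by (simp add: w_def)
  have w: "w sums (1 / 2)" using weighted_zeta_0 by (simp add: w_def)
  \<comment> \<open>The decay in \<open>k\<close> of the error at \<open>k N\<close> is dropped; the
    weights \<open>w k\<close> already have a finite sum, so the error stays of order
    \<open>1 / N ^ 12\<close>.\<close>
  have rb: "\<bar>r (Suc k * N) * w k\<bar> \<le> (C / real N ^ 12) * w k" if N: "N > 0" for k N
  proof -
    have "real N ^ 12 \<le> real (Suc k * N) ^ 12"
      by (intro power_mono) auto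
    then have "C / real (Suc k * N) ^ 12 \<le> C / real N ^ 12"
      using N C(1) by (intro divide_left_mono mult_pos_pos zero_less_power) (simp_all add: add_pos_nonneg)
    then have "\<bar>r (Suc k * N)\<bar> \<le> C / real N ^ 12"
      using C(2)[of "Suc k * N"] N unfolding r_def by fastforce
    then show ?thesis
      unfolding abs_mult abs_of_pos[OF wpos] using wpos[of k] by (intro mult_right_mono) auto
  qed
  have rsum: "summable (\<lambda>k. r (Suc k * N) * w k)" if N: "N > 0" for N
    by (rule summable_comparison_test'[where N = 0, OF summable_mult[OF sums_summable[OF w], of "C / real N ^ 12"]])
      (simp only: real_norm_def rb[OF N])
  have rsum_bound: "\<bar>\<Sum>k. r (Suc k * N) * w k\<bar> \<le> (C / real N ^ 12) * (1 / 2)" if N: "N > 0" for N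
  proof -
    have abs: "summable (\<lambda>k. \<bar>r (Suc k * N) * w k\<bar>)"
      by (rule summable_comparison_test'[where N = 0, OF summable_mult[OF sums_summable[OF w], of "C / real N ^ 12"]])
        (simp only: real_norm_def abs_abs rb[OF N])
    have "\<bar>\<Sum>k. r (Suc k * N) * w k\<bar> \<le> (\<Sum>k. \<bar>r (Suc k * N) * w k\<bar>)"
      using abs by (rule summable_rabs)
    also have "\<dots> \<le> (\<Sum>k. (C / real N ^ 12) * w k)"
      using abs rb[OF N] by (intro suminf_le summable_mult sums_summable[OF w]) auto
    also have "\<dots> = (C / real N ^ 12) * (1 / 2)"
      by (rule sums_unique[OF sums_mult[OF w], symmetric])
    finally show ?thesis .
  qed
  define h where "h = (\<lambda>N::nat. (ln (real N) + euler_mascheroni + 2 * ln 2) / 2)"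
  have split: "odd_harm (Suc k * N) * w k = ln (real (Suc k)) * w k / 2 + h N * w k
      + odd_harm_tail (2 * real (Suc k * N)) * w k + r (Suc k * N) * w k" if "N > 0" for k N
  proof -
    have "ln (real (Suc k * N)) = ln (real (Suc k)) + ln (real N)"
      unfolding of_nat_mult using that by (simp add: ln_mult del: of_nat_Suc)
    then have "odd_harm (Suc k * N) = ln (real (Suc k)) / 2 + h N
      + odd_harm_tail (2 * real (Suc k * N)) + r (Suc k * N)"
      unfolding r_def h_def by (simp add: add_divide_distrib)
    then show ?thesis by (simp only: distrib_right times_divide_eq_left)
  qed
  have L: "(\<lambda>k. odd_harm (Suc k * N) * w k) sums (pi\<^sup>2 / 16 * lebesgue_const (real n / 2))" if "N = n + 1" for n N
    using lebesgue_const_sums[of n] by (simp add: that w_def)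
  \<comment> \<open>Solving \<open>split\<close> at \<open>N = 1\<close> for the logarithmic term
    expresses it through four series already known to converge, including Szego's formula for
    \<open>n = 0\<close>.\<close>
  have lnsum: "summable (\<lambda>k. ln (real (Suc k)) * w k)"
  proof -
    have "ln (real (Suc k)) * w k = 2 * (odd_harm (Suc k * 1) * w k - h 1 * w k
      - odd_harm_tail (2 * real (Suc k * 1)) * w k - r (Suc k * 1) * w k)" for k
      using split[of 1 k] by (simp add: field_simps)
    moreover have "summable (\<lambda>k. 2 * (odd_harm (Suc k * 1) * w k - h 1 * w k
      - odd_harm_tail (2 * real (Suc k * 1)) * w k - r (Suc k * 1) * w k))"
      by (intro summable_mult summable_diff rsum sums_summable[OF w] sums_summable[OF L[of 1 0]]
          sums_summable[OF tail_w[of 1]]) auto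
    ultimately show ?thesis by presburger
  qed
  define S where "S = (\<Sum>k. ln (real (Suc k)) * w k)"
  have main: "lebesgue_const (real n / 2) - MC\<^sub>0 n - lebesgue_tail ((real n + 1)^2)
      = 16 / pi\<^sup>2 * (\<Sum>k. r (Suc k * (n + 1)) * w k)" for n
  proof -
    define N where "N = n + 1"
    have N: "N > 0" by (simp add: N_def)
    have "(\<lambda>k. ln (real (Suc k)) * w k / 2 + h N * w k
      + odd_harm_tail (2 * real (Suc k * N)) * w k + r (Suc k * N) * w k) sums
      (S / 2 + h N * (1 / 2) + pi^2 / 16 * lebesgue_tail (real N ^ 2) + (\<Sum>k. r (Suc k * N) * w k))"
      unfolding S_def
      by (intro sums_add sums_divide sums_mult w summable_sums[OF lnsum] summable_sums[OF rsum[OF N]]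
         tail_w[OF N])
    then have "(\<lambda>k. odd_harm (Suc k * N) * w k) sums
      (S / 2 + h N * (1 / 2) + pi^2 / 16 * lebesgue_tail (real N ^ 2) + (\<Sum>k. r (Suc k * N) * w k))"
      unfolding split[OF N] .
    from sums_unique2[OF L[OF N_def] this]
    have "pi\<^sup>2 / 16 * lebesgue_const (real n / 2) =
      S / 2 + h N * (1 / 2) + pi^2 / 16 * lebesgue_tail (real N ^ 2) + (\<Sum>k. r (Suc k * N) * w k)" .
    moreover have "l = 8 / pi\<^sup>2 * s + 8 / pi\<^sup>2 * h + t + 16 / pi\<^sup>2 * x"
      if "pi\<^sup>2 / 16 * l = s / 2 + h * (1 / 2) + pi\<^sup>2 / 16 * t + x" for l s h t x :: real
      using that by (simp add: field_simps)
    ultimately have "lebesgue_const (real n / 2) = 8 / pi\<^sup>2 * S + 8 / pi\<^sup>2 * h N + lebesgue_tail (real N ^ 2)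
        + 16 / pi\<^sup>2 * (\<Sum>k. r (Suc k * N) * w k)"
      by blast
    moreover have "MC\<^sub>0 n = 8 / pi\<^sup>2 * S + 8 / pi\<^sup>2 * h N"
      unfolding MC\<^sub>0_def c\<^sub>1_def S_def h_def w_def N_def
      by (simp add: add_ac distrib_left add_divide_distrib)
    ultimately show ?thesis
      by (simp add: N_def add.commute)
  qed
  show thesis
  proof (rule that[of "16 / pi\<^sup>2 * (C * (1 / 2))"])
    show "0 \<le> 16 / pi\<^sup>2 * (C * (1 / 2))" using C(1) by simp
    fix n :: nat
    have "\<bar>\<Sum>k. r (Suc k * (n + 1)) * w k\<bar> \<le> C / (real n + 1) ^ 12 * (1 / 2)"
      using rsum_bound[of "n + 1"] by (simp add: add.commute)
    then have "16 / pi\<^sup>2 * \<bar>\<Sum>k. r (Suc k * (n + 1)) * w k\<bar> \<le> 16 / pi\<^sup>2 * (C / (real n + 1) ^ 12 * (1 / 2))"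
      by (rule mult_left_mono) simp
    then show "\<bar>lebesgue_const (real n / 2) - MC\<^sub>0 n - lebesgue_tail ((real n + 1)^2)\<bar>
        \<le> 16 / pi\<^sup>2 * (C * (1 / 2)) / (real n + 1) ^ 12"
      unfolding main by (simp add: abs_mult)
  qed
qed

subsection \<open>Matching with the continued fractions\<close>

lemma pi_square_bounds: "9.8696 \<le> pi\<^sup>2" "pi\<^sup>2 \<le> 9.8697"
proof -
  have "(3.141592653588 :: real)\<^sup>2 \<le> pi\<^sup>2" "pi\<^sup>2 \<le> (3.1415926535899 :: real)\<^sup>2"
    using pi_approx by (auto intro!: power_mono)
  then show "9.8696 \<le> pi\<^sup>2" "pi\<^sup>2 \<le> 9.8697"
    by (simp_all add: power2_eq_square)
qed

text \<open>As a polynomial in \<open>p = pi^2\<close>, this is the numerator of \<open>\<rho>\<^sub>2\<close> and \<open>C\<^sub>1\<close> up to sign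
  and scaling, and a factor of the denominators of \<open>\<sigma>\<^sub>2\<close> and \<open>C\<^sub>2\<close>.\<close>

definition \<Delta> :: "real \<Rightarrow> real" where
  "\<Delta> p = 7515244800 - 1252540800 * p + 46937520 * p^2 + 65640 * p^3 + 23797 * p^4"

text \<open>The terms nearly cancel: the value is about \<open>1.4 * 10^7\<close>, while the largest
  terms are of order \<open>10^10\<close>. The lower bound on \<open>pi^2\<close> is used in the
  higher powers and the upper bound in the negative linear term.\<close>

lemma \<Delta>_pos: "\<Delta> (pi\<^sup>2) > 0"
proof -
  have "(9.8696::real) ^ i \<le> (pi\<^sup>2) ^ i" for i
    using pi_square_bounds by (intro power_mono) auto
  from this[of 2] this[of 3] this[of 4] pi_square_bounds show ?thesis
    unfolding \<Delta>_def by (simp add: power2_eq_square power3_eq_cube power4_eq_xxxx)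
qed

lemma pi_even_powers:
  "pi ^ 4 = (pi\<^sup>2) ^ 2" "pi ^ 6 = (pi\<^sup>2) ^ 3" "pi ^ 8 = (pi\<^sup>2) ^ 4" "pi ^ 10 = (pi\<^sup>2) ^ 5"
  "pi ^ 12 = (pi\<^sup>2) ^ 6" "pi ^ 14 = (pi\<^sup>2) ^ 7" "pi ^ 16 = (pi\<^sup>2) ^ 8" "pi ^ 18 = (pi\<^sup>2) ^ 9"
  by (simp_all flip: power_mult)

text \<open>The matching conditions with denominators cleared, valid for every real
  \<open>p\<close>. At \<open>p = pi^2\<close> one has
  \<open>\<sigma>\<^sub>1 = \<alpha> / g\<close>, \<open>\<rho>\<^sub>2 = \<beta> / g^2\<close> and
  \<open>\<sigma>\<^sub>2 = \<delta> / (g * \<Delta> p)\<close>. The factor 288 is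
  \<open>16 * 18\<close>, from \<open>16 / p\<close> in \<open>lebesgue_tail\<close> and
  \<open>\<rho>\<^sub>1 = - g / (18 * p)\<close>.\<close>

lemma coefficient_identities:
  fixes p :: real
  defines "g \<equiv> p - 12" and "\<alpha> \<equiv> 7 * (-720 + 60 * p + p^2) / 600"
    and "\<delta> \<equiv> 7 * (-36262162944000 + 9065540736000 * p - 720128102400 * p^2
              + 16206350400 * p^3 + 117169920 * p^4 + 288540 * p^5 + 230953 * p^6) / 600"
    and "\<beta> \<equiv> - \<Delta> p / 52920000"
  shows "288 * (-7/1920 * (8 - 2 * p / 3 - p^2 / 90)) = \<alpha>"
    and "288 * (31/16128 * (32 - 8 * p / 3 - 2 * p^2 / 45 - p^3 / 945)) * g = \<beta> - \<alpha>^2"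
    and "288 * (-127/61440 * (128 - 32 * p / 3 - 8 * p^2 / 45 - 4 * p^3 / 945 - p^4 / 9450)) * g^2
           = \<alpha>^3 - 2 * \<alpha> * \<beta> + \<delta> / 52920000"
    and "288 * (511/135168 * (512 - 128 * p / 3 - 32 * p^2 / 45 - 16 * p^3 / 945 - 2 * p^4 / 4725 - p^5 / 93555)) * g^3 * \<Delta> p
           + \<Delta> p * (\<alpha>^4 - 3 * \<alpha>^2 * \<beta> + 2 * \<alpha> * \<delta> / 52920000 + \<beta>^2) + \<delta>^2 / 52920000
         = 18 * g^3 * ((7633889107527073628160000
        - 1908472276881768407040000 * p
        + 146687085183488661504000 * p^2
        - 3184401328004768256000 * p^3
        + 50811629937851059200 * p^4
        - 5860796365392595200 * p^5
        + 73433337261096960 * p^6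
        - 2698623258901920 * p^7
        - 13989723377364 * p^8
        - 552278517605 * p^9) / 97592743987200)"
  unfolding g_def \<alpha>_def \<delta>_def \<beta>_def \<Delta>_def by algebra+

text \<open>A remainder two orders below the main term stays negligible after multiplication by
  \<open>n ^ (p + 1)\<close>, at \<open>n\<close> and at \<open>n + 1\<close> alike, so only the
  main term contributes to the difference. Its limit is the hypothesis \<open>lim\<close>, which is
  checked later for the numerals 6 and 10.\<close>

lemma limits_of_inverse_power_expansion:
  fixes E :: "nat \<Rightarrow> real"
  assumes bigo: "(\<lambda>n. E n - C / (real n + 1) ^ p) \<in> O(\<lambda>n. 1 / (real n + 1) ^ (p + 2))"
    and lim: "(\<lambda>n. real n ^ (p + 1) * (1 / (real n + 1) ^ p - 1 / (real n + 2) ^ p)) \<longlonglongrightarrow> real p"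
  shows "(\<lambda>n. real n ^ (p + 1) * (E n - E (n + 1))) \<longlonglongrightarrow> real p * C"
    and "(\<lambda>n. real n ^ p * E n) \<longlonglongrightarrow> C"
proof -
  define r where "r = (\<lambda>n. E n - C / (real n + 1) ^ p)"
  obtain K where K: "\<forall>\<^sub>F n in sequentially. norm (r n) \<le> K * norm (1 / (real n + 1) ^ (p + 2))"
    using landau_o.bigE[OF bigo] unfolding r_def by blast
  have z: "(\<lambda>n. K * (1 / (real n + 1))) \<longlonglongrightarrow> 0"
    by (rule tendsto_mult_right_zero) real_asymp
  have small: "(\<lambda>n. (real n + 1) ^ (p + 1) * r n) \<longlonglongrightarrow> 0"
  proof (rule Lim_null_comparison[OF _ z])
    show "\<forall>\<^sub>F n in sequentially. norm ((real n + 1) ^ (p + 1) * r n) \<le> K * (1 / (real n + 1))"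
      using K
    proof eventually_elim
      case (elim n)
      have e: "norm ((real n + 1) ^ (p + 1)) = (real n + 1) ^ (p + 1)" by simp
      have "norm ((real n + 1) ^ (p + 1) * r n) \<le> (real n + 1) ^ (p + 1) * (K * norm (1 / (real n + 1) ^ (p + 2)))"
        unfolding norm_mult e by (rule mult_left_mono[OF elim]) simp
      also have "\<dots> = K * (1 / (real n + 1))"
        by (simp add: power_add power2_eq_square divide_simps)
      finally show ?case .
    qed
  qed
  have shrink: "(\<lambda>n. real n ^ i * r n) \<longlonglongrightarrow> 0" if "i \<le> p + 1" for i
  proof (rule Lim_null_comparison[OF _ tendsto_norm_zero[OF small]])
    show "\<forall>\<^sub>F n in sequentially. norm (real n ^ i * r n) \<le> norm ((real n + 1) ^ (p + 1) * r n)"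
    proof (rule always_eventually, rule allI)
      fix n
      have "real n ^ i \<le> (real n + 1) ^ i" by (intro power_mono) auto
      also have "\<dots> \<le> (real n + 1) ^ (p + 1)" using that by (intro power_increasing) auto
      finally show "norm (real n ^ i * r n) \<le> norm ((real n + 1) ^ (p + 1) * r n)"
        unfolding norm_mult by (intro mult_right_mono) (auto simp: abs_if)
    qed
  qed
  have shrink': "(\<lambda>n. real n ^ (p + 1) * r (n + 1)) \<longlonglongrightarrow> 0"
  proof (rule Lim_null_comparison[OF _ tendsto_norm_zero[OF LIMSEQ_ignore_initial_segment[OF small, of 1]]])
    show "\<forall>\<^sub>F n in sequentially. norm (real n ^ (p + 1) * r (n + 1)) \<le> norm ((real (n + 1) + 1) ^ (p + 1) * r (n + 1))"
    proof (rule always_eventually, rule allI)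
      fix n
      have "real n ^ (p + 1) \<le> (real (n + 1) + 1) ^ (p + 1)" by (intro power_mono) auto
      moreover have "norm (real n ^ (p + 1)) = real n ^ (p + 1)"
        "norm ((real (n + 1) + 1) ^ (p + 1)) = (real (n + 1) + 1) ^ (p + 1)" by simp_all
      ultimately show "norm (real n ^ (p + 1) * r (n + 1)) \<le> norm ((real (n + 1) + 1) ^ (p + 1) * r (n + 1))"
        unfolding norm_mult by (intro mult_right_mono) simp_all
    qed
  qed
  have E: "E n = C / (real n + 1) ^ p + r n" for n
    by (simp add: r_def)
  have "(\<lambda>n. C * (real n ^ (p + 1) * (1 / (real n + 1) ^ p - 1 / (real n + 2) ^ p))
        + (real n ^ (p + 1) * r n - real n ^ (p + 1) * r (n + 1))) \<longlonglongrightarrow> C * real p + (0 - 0)"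
    by (intro tendsto_add tendsto_mult tendsto_diff tendsto_const lim shrink shrink') simp
  moreover have "C * (real n ^ (p + 1) * (1 / (real n + 1) ^ p - 1 / (real n + 2) ^ p))
        + (real n ^ (p + 1) * r n - real n ^ (p + 1) * r (n + 1)) = real n ^ (p + 1) * (E n - E (n + 1))" for n
  proof -
    have "real (n + 1) + 1 = real n + 2" by simp
    then show ?thesis
      unfolding E[of n] E[of "n + 1"] by (simp only:) (simp add: algebra_simps)
  qed
  ultimately show "(\<lambda>n. real n ^ (p + 1) * (E n - E (n + 1))) \<longlonglongrightarrow> real p * C"
    by (simp add: mult.commute)
  have "(\<lambda>n. real n / (real n + 1)) \<longlonglongrightarrow> 1" by real_asymp
  then have "(\<lambda>n. C * (real n / (real n + 1)) ^ p + real n ^ p * r n) \<longlonglongrightarrow> C * 1 ^ p + 0"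
    by (intro tendsto_add tendsto_mult tendsto_power tendsto_const shrink) auto
  then show "(\<lambda>n. real n ^ p * E n) \<longlonglongrightarrow> C"
    by (simp add: E distrib_left power_divide mult.commute)
qed

text \<open>The geometric expansion stopped after three terms with its exact remainder, which is of
  order \<open>1 / y ^ 4\<close>.\<close>

lemma inverse_add_expansion:
  fixes y s \<rho> :: real
  assumes "y \<noteq> 0" "y + s \<noteq> 0"
  shows "\<rho> / (y + s) = \<rho> / y - \<rho> * s / y^2 + \<rho> * s^2 / y^3 - \<rho> * s^3 * (1 / (y^3 * (y + s)))"
proof -
  have "\<rho> * y^3 = (\<rho> * y^2 - \<rho> * s * y + \<rho> * s^2) * (y + s) - \<rho> * s^3" by algebra
  then have "\<rho> * y^3 / (y^3 * (y + s)) = ((\<rho> * y^2 - \<rho> * s * y + \<rho> * s^2) * (y + s) - \<rho> * s^3) / (y^3 * (y + s))"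
    by simp
  then show ?thesis
    using assms by (simp add: diff_divide_distrib add_divide_distrib power2_eq_square power3_eq_cube)
qed

text \<open>The fraction equals \<open>\<rho> * (y + \<sigma>') / D\<close> with \<open>D\<close>
  quadratic in \<open>y\<close>, and long division gives coefficients with \<open>c j = - (\<sigma>
  + \<sigma>') * c (j - 1) - (\<sigma> * \<sigma>' + \<rho>') * c (j - 2)\<close> for
  \<open>j \<ge> 3\<close>; \<open>f4\<close> and \<open>f5\<close> are \<open>c 4\<close> and
  \<open>c 5\<close>. The last two summands are the exact remainder, of order
  \<open>1 / y ^ 6\<close>.\<close>

lemma continued_fraction_expansion:
  fixes y \<rho> \<sigma> \<rho>' \<sigma>' :: real
  assumes y: "y \<noteq> 0" "y + \<sigma>' \<noteq> 0" and Q: "(y + \<sigma>) * (y + \<sigma>') + \<rho>' \<noteq> 0"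
  defines "f4 \<equiv> - \<rho> * (\<sigma>^3 - 2 * \<sigma> * \<rho>' - \<sigma>' * \<rho>')"
    and "f5 \<equiv> \<rho> * (\<sigma>^4 - 3 * \<sigma>^2 * \<rho>' - 2 * \<sigma> * \<sigma>' * \<rho>' - \<sigma>'^2 * \<rho>' + \<rho>'^2)"
  shows "\<rho> / (y + \<sigma> + \<rho>' / (y + \<sigma>'))
     = \<rho> / y - \<rho> * \<sigma> / y^2 + \<rho> * (\<sigma>^2 - \<rho>') / y^3 + f4 / y^4 + f5 / y^5
       - ((\<sigma> + \<sigma>') * f5 + (\<sigma> * \<sigma>' + \<rho>') * f4) * (1 / (y^4 * ((y + \<sigma>) * (y + \<sigma>') + \<rho>')))
       - (\<sigma> * \<sigma>' + \<rho>') * f5 * (1 / (y^5 * ((y + \<sigma>) * (y + \<sigma>') + \<rho>')))"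
proof -
  define D where "D = (y + \<sigma>) * (y + \<sigma>') + \<rho>'"
  have D: "D \<noteq> 0" using Q by (simp add: D_def)
  have "y + \<sigma> + \<rho>' / (y + \<sigma>') = D / (y + \<sigma>')"
    using y by (simp add: D_def field_simps)
  then have 1: "\<rho> / (y + \<sigma> + \<rho>' / (y + \<sigma>')) = \<rho> * (y + \<sigma>') / D"
    by simp
  have key: "\<rho> * (y + \<sigma>') * y^5 = (\<rho> * y^4 - \<rho> * \<sigma> * y^3 + \<rho> * (\<sigma>^2 - \<rho>') * y^2 + f4 * y + f5) * D
      - ((\<sigma> + \<sigma>') * f5 + (\<sigma> * \<sigma>' + \<rho>') * f4) * y - (\<sigma> * \<sigma>' + \<rho>') * f5"
    unfolding D_def f4_def f5_def by algebra
  have "\<rho> * (y + \<sigma>') / D = \<rho> * (y + \<sigma>') * y^5 / (y^5 * D)" using y by simp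
  also have "\<dots> = (\<rho> * y^4 - \<rho> * \<sigma> * y^3 + \<rho> * (\<sigma>^2 - \<rho>') * y^2 + f4 * y + f5) * D / (y^5 * D)
      - ((\<sigma> + \<sigma>') * f5 + (\<sigma> * \<sigma>' + \<rho>') * f4) * y / (y^5 * D) - (\<sigma> * \<sigma>' + \<rho>') * f5 / (y^5 * D)"
    unfolding key by (simp only: diff_divide_distrib)
  also have "(\<rho> * y^4 - \<rho> * \<sigma> * y^3 + \<rho> * (\<sigma>^2 - \<rho>') * y^2 + f4 * y + f5) * D / (y^5 * D)
      = (\<rho> * y^4 - \<rho> * \<sigma> * y^3 + \<rho> * (\<sigma>^2 - \<rho>') * y^2 + f4 * y + f5) / y^5"
    using D by simp
  also have "\<dots> = \<rho> / y - \<rho> * \<sigma> / y^2 + \<rho> * (\<sigma>^2 - \<rho>') / y^3 + f4 / y^4 + f5 / y^5"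
  proof -
    have "y^4 / y^5 = 1 / y" "y^3 / y^5 = 1 / y^2" "y^2 / y^5 = 1 / y^3" "y / y^5 = 1 / y^4"
      using y by (simp_all add: eval_nat_numeral)
    then show ?thesis
      by (simp only: add_divide_distrib diff_divide_distrib times_divide_eq_right[symmetric])
        (simp add: right_diff_distrib diff_divide_distrib)
  qed
  also have "((\<sigma> + \<sigma>') * f5 + (\<sigma> * \<sigma>' + \<rho>') * f4) * y / (y^5 * D)
     = ((\<sigma> + \<sigma>') * f5 + (\<sigma> * \<sigma>' + \<rho>') * f4) * (1 / (y^4 * D))"
  proof -
    have "y / (y^5 * D) = 1 / (y^4 * D)" using y by (simp add: eval_nat_numeral)
    then show ?thesis by (simp only: times_divide_eq_right[symmetric])
  qed
  finally show ?thesis unfolding 1 D_def by simp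
qed


text \<open>Each pair of parameters matches two further powers of \<open>1 / y\<close>:
  \<open>\<rho>\<^sub>1\<close> and \<open>\<sigma>\<^sub>1\<close> the first two,
  \<open>\<rho>\<^sub>2\<close> and \<open>\<sigma>\<^sub>2\<close> the third and fourth. The
  defects are therefore \<open>C\<^sub>1\<close> at \<open>1 / y ^ 3\<close> and
  \<open>C\<^sub>2\<close> at \<open>1 / y ^ 5\<close>, which explains the exponent
  \<open>4 k + 2\<close>. In particular
  \<open>C\<^sub>1 = - \<rho>\<^sub>1 * \<rho>\<^sub>2\<close>.\<close>

lemma MC_coefficients:
  defines "p \<equiv> pi\<^sup>2"
  defines "a1 \<equiv> 16 / p * (1/48 * (2 - p / 6))"
    and "a2 \<equiv> 16 / p * (-7/1920 * (8 - 2 * p / 3 - p^2 / 90))"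
    and "a3 \<equiv> 16 / p * (31/16128 * (32 - 8 * p / 3 - 2 * p^2 / 45 - p^3 / 945))"
    and "a4 \<equiv> 16 / p * (-127/61440 * (128 - 32 * p / 3 - 8 * p^2 / 45 - 4 * p^3 / 945 - p^4 / 9450))"
    and "a5 \<equiv> 16 / p * (511/135168 * (512 - 128 * p / 3 - 32 * p^2 / 45 - 16 * p^3 / 945 - 2 * p^4 / 4725 - p^5 / 93555))"
  shows "lebesgue_tail y = a1 / y + a2 / y^2 + a3 / y^3 + a4 / y^4 + a5 / y^5"
    and "a1 = \<rho>\<^sub>1" and "a2 = - \<rho>\<^sub>1 * \<sigma>\<^sub>1"
    and "a3 - \<rho>\<^sub>1 * \<sigma>\<^sub>1^2 = C\<^sub>1"
    and "a3 = \<rho>\<^sub>1 * (\<sigma>\<^sub>1^2 - \<rho>\<^sub>2)"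
    and "a4 = - \<rho>\<^sub>1 * (\<sigma>\<^sub>1^3 - 2 * \<sigma>\<^sub>1 * \<rho>\<^sub>2 - \<sigma>\<^sub>2 * \<rho>\<^sub>2)"
    and "a5 - \<rho>\<^sub>1 * (\<sigma>\<^sub>1^4 - 3 * \<sigma>\<^sub>1^2 * \<rho>\<^sub>2 - 2 * \<sigma>\<^sub>1 * \<sigma>\<^sub>2 * \<rho>\<^sub>2 - \<sigma>\<^sub>2^2 * \<rho>\<^sub>2 + \<rho>\<^sub>2^2) = C\<^sub>2"
proof -
  define g where "g = p - 12"
  define D where "D = \<Delta> p"
  define \<alpha> where "\<alpha> = 7 * (-720 + 60 * p + p^2) / 600"
  define \<delta> where "\<delta> = 7 * (-36262162944000 + 9065540736000 * p - 720128102400 * p^2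
              + 16206350400 * p^3 + 117169920 * p^4 + 288540 * p^5 + 230953 * p^6) / 600"
  define \<beta> where "\<beta> = - D / 52920000"
  define N where "N = (7633889107527073628160000
        - 1908472276881768407040000 * p
        + 146687085183488661504000 * p^2
        - 3184401328004768256000 * p^3
        + 50811629937851059200 * p^4
        - 5860796365392595200 * p^5
        + 73433337261096960 * p^6
        - 2698623258901920 * p^7
        - 13989723377364 * p^8
        - 552278517605 * p^9) / 97592743987200"
  define t2 t3 t4 t5 where t:
    "t2 = -7/1920 * (8 - 2 * p / 3 - p^2 / 90)"
    "t3 = 31/16128 * (32 - 8 * p / 3 - 2 * p^2 / 45 - p^3 / 945)"
    "t4 = -127/61440 * (128 - 32 * p / 3 - 8 * p^2 / 45 - 4 * p^3 / 945 - p^4 / 9450)"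
    "t5 = 511/135168 * (512 - 128 * p / 3 - 32 * p^2 / 45 - 16 * p^3 / 945 - 2 * p^4 / 4725 - p^5 / 93555)"
  have p: "p > 0" by (simp add: p_def)
  have g: "g \<noteq> 0" using pi_square_bounds by (simp add: g_def p_def)
  have D: "D \<noteq> 0" using \<Delta>_pos by (simp add: D_def p_def)
  note id = coefficient_identities[of p, folded D_def, folded g_def \<alpha>_def \<delta>_def \<beta>_def, folded N_def, folded t]
  have \<rho>1: "\<rho>\<^sub>1 = - g / (18 * p)"
    by (simp add: \<rho>\<^sub>1_def g_def p_def)
  have \<sigma>1: "\<sigma>\<^sub>1 = \<alpha> / g"
    unfolding \<sigma>\<^sub>1_def pi_even_powers g_def \<alpha>_def p_def by (simp add: add.commute)
  have \<rho>2: "\<rho>\<^sub>2 = \<beta> / g^2"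
  proof -
    have "\<rho>\<^sub>2 = - (D / (52920000 * g^2))"
      unfolding \<rho>\<^sub>2_def pi_even_powers g_def D_def \<Delta>_def p_def uminus_add_conv_diff ..
    then show ?thesis by (simp add: \<beta>_def)
  qed
  have \<sigma>2: "\<sigma>\<^sub>2 = \<delta> / (g * D)"
  proof -
    have "g * D = -90182937600 + 22545734400 * p - 1815791040 * p^2 + 46149840 * p^3 - 219924 * p^4 + 23797 * p^5"
      unfolding g_def D_def \<Delta>_def by algebra
    then show ?thesis
      unfolding \<sigma>\<^sub>2_def pi_even_powers \<delta>_def p_def by simp
  qed
  have C1: "C\<^sub>1 = \<beta> / (18 * p * g)"
  proof -
    have "-7515244800 + 1252540800 * p - 46937520 * p^2 - 65640 * p^3 - 23797 * p^4 = - D"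
      by (simp add: D_def \<Delta>_def)
    then have "C\<^sub>1 = - D / (952560000 * p * g)"
      unfolding C\<^sub>1_def pi_even_powers p_def[symmetric] g_def uminus_add_conv_diff by simp
    then show ?thesis by (simp add: \<beta>_def)
  qed
  have C2: "C\<^sub>2 = N / (p * D)"
    unfolding C\<^sub>2_def N\<^sub>2_def pi_even_powers N_def D_def \<Delta>_def p_def[symmetric]
    by simp
  have \<beta>D: "\<beta> / D = - 1 / 52920000" using D by (simp add: \<beta>_def)
  have a: "a2 = 288 * t2 / (18 * p)" "a3 = 288 * t3 / (18 * p)" "a4 = 288 * t4 / (18 * p)" "a5 = 288 * t5 / (18 * p)"
  proof -
    have "16 / p * x = 288 * x / (18 * p)" for x by simp
    then show "a2 = 288 * t2 / (18 * p)" "a3 = 288 * t3 / (18 * p)" "a4 = 288 * t4 / (18 * p)" "a5 = 288 * t5 / (18 * p)"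
      unfolding a2_def a3_def a4_def a5_def t by this+
  qed
  show "lebesgue_tail y = a1 / y + a2 / y^2 + a3 / y^3 + a4 / y^4 + a5 / y^5"
  proof -
    have "16 / p * (x1 / y - x2 / y^2 + x3 / y^3 - x4 / y^4 + x5 / y^5)
       = 16 / p * x1 / y + 16 / p * (- x2) / y^2 + 16 / p * x3 / y^3 + 16 / p * (- x4) / y^4 + 16 / p * x5 / y^5" for x1 x2 x3 x4 x5
      by (simp add: distrib_left right_diff_distrib)
    then show ?thesis
      unfolding lebesgue_tail_def pi_even_powers p_def[symmetric] a1_def a2_def a3_def a4_def a5_def
      by (simp only: mult_minus_left minus_divide_left)
  qed
  show "a1 = \<rho>\<^sub>1"
    unfolding a1_def \<rho>1 g_def using p by (simp add: field_simps)
  show "a2 = - \<rho>\<^sub>1 * \<sigma>\<^sub>1"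
    unfolding a \<rho>1 \<sigma>1 id(1) using g by simp
  have a3: "a3 = (\<beta> - \<alpha>^2) / (18 * p * g)"
    unfolding a id(2)[symmetric] using g by simp
  have \<rho>\<sigma>: "\<rho>\<^sub>1 * \<sigma>\<^sub>1^2 = - (\<alpha>^2) / (18 * p * g)"
    unfolding \<rho>1 \<sigma>1 using g by (simp add: power_divide power2_eq_square)
  show "a3 - \<rho>\<^sub>1 * \<sigma>\<^sub>1^2 = C\<^sub>1"
    unfolding a3 \<rho>\<sigma> C1 by (simp add: diff_divide_distrib)
  show "a3 = \<rho>\<^sub>1 * (\<sigma>\<^sub>1^2 - \<rho>\<^sub>2)"
  proof -
    have "\<rho>\<^sub>1 * \<rho>\<^sub>2 = - \<beta> / (18 * p * g)"
      unfolding \<rho>1 \<rho>2 using g by (simp add: power2_eq_square)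
    then show ?thesis
      unfolding right_diff_distrib \<rho>\<sigma> a3 by (simp add: diff_divide_distrib)
  qed
  \<comment> \<open>The numerator of \<open>\<rho>\<^sub>2\<close> is a multiple of \<open>D\<close>
    and cancels it in \<open>\<sigma>\<^sub>2\<close>. Hence \<open>D\<close> drops out of the
    fourth coefficient and survives once in \<open>\<sigma>\<^sub>2^2 * \<rho>\<^sub>2\<close>, from
    where it enters the denominator of \<open>C\<^sub>2\<close>.\<close>
  have s2r2: "\<sigma>\<^sub>2 * \<rho>\<^sub>2 = - \<delta> / (52920000 * g^3)"
  proof -
    have "\<sigma>\<^sub>2 * \<rho>\<^sub>2 = \<delta> * (\<beta> / D) / g^3"
      unfolding \<sigma>2 \<rho>2 by (simp add: power2_eq_square power3_eq_cube)
    then show ?thesis unfolding \<beta>D by simp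
  qed
  show "a4 = - \<rho>\<^sub>1 * (\<sigma>\<^sub>1^3 - 2 * \<sigma>\<^sub>1 * \<rho>\<^sub>2 - \<sigma>\<^sub>2 * \<rho>\<^sub>2)"
  proof -
    have "\<sigma>\<^sub>1^3 - 2 * \<sigma>\<^sub>1 * \<rho>\<^sub>2 - \<sigma>\<^sub>2 * \<rho>\<^sub>2 = (\<alpha>^3 - 2 * \<alpha> * \<beta> + \<delta> / 52920000) / g^3"
      unfolding s2r2 unfolding \<sigma>1 \<rho>2
      by (simp add: power_divide power2_eq_square power3_eq_cube diff_divide_distrib add_divide_distrib)
    also have "\<dots> = 288 * t4 * g^2 / g^3" unfolding id(3) ..
    also have "\<dots> = 288 * t4 / g" using g by (simp add: power2_eq_square power3_eq_cube)
    finally show ?thesis unfolding a \<rho>1 using g by simp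
  qed
  show "a5 - \<rho>\<^sub>1 * (\<sigma>\<^sub>1^4 - 3 * \<sigma>\<^sub>1^2 * \<rho>\<^sub>2 - 2 * \<sigma>\<^sub>1 * \<sigma>\<^sub>2 * \<rho>\<^sub>2 - \<sigma>\<^sub>2^2 * \<rho>\<^sub>2 + \<rho>\<^sub>2^2) = C\<^sub>2"
  proof -
    define X where "X = \<alpha>^4 - 3 * \<alpha>^2 * \<beta> + 2 * \<alpha> * \<delta> / 52920000 + \<beta>^2"
    have "\<sigma>\<^sub>1^4 - 3 * \<sigma>\<^sub>1^2 * \<rho>\<^sub>2 - 2 * \<sigma>\<^sub>1 * \<sigma>\<^sub>2 * \<rho>\<^sub>2 - \<sigma>\<^sub>2^2 * \<rho>\<^sub>2 + \<rho>\<^sub>2^2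
      = \<sigma>\<^sub>1^4 - 3 * \<sigma>\<^sub>1^2 * \<rho>\<^sub>2 - 2 * \<sigma>\<^sub>1 * (\<sigma>\<^sub>2 * \<rho>\<^sub>2) - \<sigma>\<^sub>2 * (\<sigma>\<^sub>2 * \<rho>\<^sub>2) + \<rho>\<^sub>2^2"
      by (simp add: power2_eq_square)
    also have "\<dots> = (\<alpha>^4 - 3 * \<alpha>^2 * \<beta> + 2 * \<alpha> * \<delta> / 52920000 + \<delta>^2 / (52920000 * D) + \<beta>^2) / g^4"
      unfolding s2r2 unfolding \<sigma>1 \<rho>2 \<sigma>2
      by (simp add: power_divide power2_eq_square power3_eq_cube power4_eq_xxxx diff_divide_distrib add_divide_distrib mult_ac)
    also have "\<dots> = (X + \<delta>^2 / 52920000 / D) / g^4"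
      by (simp add: X_def)
    also have "X + \<delta>^2 / 52920000 / D = (D * X + \<delta>^2 / 52920000) / D"
      using D by (simp add: add_divide_distrib)
    also have "D * X + \<delta>^2 / 52920000 = 18 * g^3 * N - 288 * t5 * g^3 * D"
      using id(4) by (simp add: X_def)
    finally have "\<rho>\<^sub>1 * (\<sigma>\<^sub>1^4 - 3 * \<sigma>\<^sub>1^2 * \<rho>\<^sub>2 - 2 * \<sigma>\<^sub>1 * \<sigma>\<^sub>2 * \<rho>\<^sub>2 - \<sigma>\<^sub>2^2 * \<rho>\<^sub>2 + \<rho>\<^sub>2^2)
      = \<rho>\<^sub>1 * ((18 * g^3 * N - 288 * t5 * g^3 * D) / D / g^4)" by simp
    also have "\<dots> = 288 * t5 / (18 * p) - N / (p * D)"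
      unfolding \<rho>1 using g D p by (simp add: divide_simps) algebra
    finally show ?thesis unfolding a C2 by simp
  qed
qed

text \<open>The powers \<open>1 / y\<close> and \<open>1 / y ^ 2\<close> cancel and
  \<open>1 / y ^ 3\<close> leaves \<open>C\<^sub>1\<close>. What remains, collected in
  \<open>f\<close>, starts at \<open>1 / y ^ 4 = 1 / (n + 1) ^ 8\<close>.\<close>

lemma MC_error_1_bigo:
  "(\<lambda>n. MC_error 1 n - C\<^sub>1 / (real n + 1) ^ 6) \<in> O(\<lambda>n. 1 / (real n + 1) ^ (6 + 2))"
proof -
  define R where "R = (\<lambda>n. lebesgue_const (real n / 2) - MC\<^sub>0 n - lebesgue_tail ((real n + 1)^2))"
  define p where "p = pi\<^sup>2"
  define a4 where "a4 = 16 / p * (-127/61440 * (128 - 32 * p / 3 - 8 * p^2 / 45 - 4 * p^3 / 945 - p^4 / 9450))"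
  define a5 where "a5 = 16 / p * (511/135168 * (512 - 128 * p / 3 - 32 * p^2 / 45 - 16 * p^3 / 945 - 2 * p^4 / 4725 - p^5 / 93555))"
  define f where "f = (\<lambda>n. R n + a4 * (1 / (real n + 1) ^ 8) + a5 * (1 / (real n + 1) ^ 10)
     + \<rho>\<^sub>1 * \<sigma>\<^sub>1^3 * (1 / (((real n + 1)^2)^3 * ((real n + 1)^2 + \<sigma>\<^sub>1))))"
  \<comment> \<open>For large \<open>n\<close> the square dominates the shift, whatever its sign, so
    the denominator is nonzero.\<close>
  have "\<forall>\<^sub>F n in sequentially. (real n + 1)^2 + \<sigma>\<^sub>1 > 0"
    by real_asymp
  then have eq: "\<forall>\<^sub>F n in sequentially. MC_error 1 n - C\<^sub>1 / (real n + 1) ^ 6 = f n"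
  proof eventually_elim
    case (elim n)
    define y where "y = (real n + 1)^2"
    have "y \<noteq> 0" "y + \<sigma>\<^sub>1 \<noteq> 0" using elim by (simp_all add: y_def)
    note mc = inverse_add_expansion[OF this, of \<rho>\<^sub>1]
    note tail = MC_coefficients(1)[of y, unfolded MC_coefficients(2,3), folded p_def, folded a4_def a5_def]
    have y: "(real n + 1) ^ 6 = y ^ 3" "(real n + 1) ^ 8 = y ^ 4" "(real n + 1) ^ 10 = y ^ 5"
      by (simp_all add: y_def flip: power_mult)
    have "MC_error 1 n = R n + lebesgue_tail y - \<rho>\<^sub>1 / (y + \<sigma>\<^sub>1)"
      by (simp add: MC_error_def MC_def MC\<^sub>1_def R_def y_def)
    then show ?case
      unfolding f_def y y_def[symmetric] mc tail MC_coefficients(4)[symmetric, folded p_def]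
      by (simp add: diff_divide_distrib)
  qed
  have "f \<in> O(\<lambda>n. 1 / (real n + 1) ^ 8)"
  proof -
    obtain C where "C \<ge> 0" "\<And>n. \<bar>R n\<bar> \<le> C / (real n + 1) ^ 12"
      using lebesgue_const_expansion unfolding R_def by blast
    then have "R \<in> O(\<lambda>n. 1 / (real n + 1) ^ 12)"
      by (intro bigoI[of _ C]) auto
    also have "(\<lambda>n. 1 / (real n + 1) ^ 12) \<in> O(\<lambda>n. 1 / (real n + 1) ^ 8)"
      by real_asymp
    finally have "R \<in> O(\<lambda>n. 1 / (real n + 1) ^ 8)" .
    moreover have "(\<lambda>n. c * (1 / (real n + 1) ^ 8)) \<in> O(\<lambda>n. 1 / (real n + 1) ^ 8)" for c :: real
      by real_asymp
    moreover have "(\<lambda>n. c * (1 / (real n + 1) ^ 10)) \<in> O(\<lambda>n. 1 / (real n + 1) ^ 8)" for c :: real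
      by real_asymp
    moreover have "(\<lambda>n. c * (1 / (((real n + 1)^2)^3 * ((real n + 1)^2 + \<sigma>\<^sub>1)))) \<in> O(\<lambda>n. 1 / (real n + 1) ^ 8)" for c :: real
      by real_asymp
    ultimately show ?thesis unfolding f_def by (intro sum_in_bigo)
  qed
  then show ?thesis
    by (subst landau_o.big.in_cong[OF eq]) simp
qed

text \<open>Here four powers of \<open>1 / y\<close> cancel and the fifth leaves
  \<open>C\<^sub>2\<close>; both the error of the Lebesgue expansion and the remainder of the
  continued fraction have order \<open>1 / (n + 1) ^ 12\<close>.\<close>

lemma MC_error_2_bigo:
  "(\<lambda>n. MC_error 2 n - C\<^sub>2 / (real n + 1) ^ 10) \<in> O(\<lambda>n. 1 / (real n + 1) ^ (10 + 2))"
proof -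
  define R where "R = (\<lambda>n. lebesgue_const (real n / 2) - MC\<^sub>0 n - lebesgue_tail ((real n + 1)^2))"
  define p where "p = pi\<^sup>2"
  define a5 where "a5 = 16 / p * (511/135168 * (512 - 128 * p / 3 - 32 * p^2 / 45 - 16 * p^3 / 945 - 2 * p^4 / 4725 - p^5 / 93555))"
  define f4 where "f4 = - \<rho>\<^sub>1 * (\<sigma>\<^sub>1^3 - 2 * \<sigma>\<^sub>1 * \<rho>\<^sub>2 - \<sigma>\<^sub>2 * \<rho>\<^sub>2)"
  define f5 where "f5 = \<rho>\<^sub>1 * (\<sigma>\<^sub>1^4 - 3 * \<sigma>\<^sub>1^2 * \<rho>\<^sub>2 - 2 * \<sigma>\<^sub>1 * \<sigma>\<^sub>2 * \<rho>\<^sub>2 - \<sigma>\<^sub>2^2 * \<rho>\<^sub>2 + \<rho>\<^sub>2^2)"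
  define Q where "Q = (\<lambda>y. (y + \<sigma>\<^sub>1) * (y + \<sigma>\<^sub>2) + \<rho>\<^sub>2)"
  define f where "f = (\<lambda>n. R n + ((\<sigma>\<^sub>1 + \<sigma>\<^sub>2) * f5 + (\<sigma>\<^sub>1 * \<sigma>\<^sub>2 + \<rho>\<^sub>2) * f4) * (1 / (((real n + 1)^2)^4 * Q ((real n + 1)^2)))
      + (\<sigma>\<^sub>1 * \<sigma>\<^sub>2 + \<rho>\<^sub>2) * f5 * (1 / (((real n + 1)^2)^5 * Q ((real n + 1)^2))))"
  have "\<forall>\<^sub>F n in sequentially. (real n + 1)^2 + \<sigma>\<^sub>2 > 0" "\<forall>\<^sub>F n in sequentially. Q ((real n + 1)^2) > 0"
    unfolding Q_def by real_asymp+
  then have eq: "\<forall>\<^sub>F n in sequentially. MC_error 2 n - C\<^sub>2 / (real n + 1) ^ 10 = f n"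
  proof eventually_elim
    case (elim n)
    define y where "y = (real n + 1)^2"
    have "y \<noteq> 0" "y + \<sigma>\<^sub>2 \<noteq> 0" "(y + \<sigma>\<^sub>1) * (y + \<sigma>\<^sub>2) + \<rho>\<^sub>2 \<noteq> 0"
      using elim by (simp_all add: y_def Q_def)
    note mc = continued_fraction_expansion[OF this,
        of \<rho>\<^sub>1, folded f4_def f5_def, folded Q_def]
    note tail = MC_coefficients(1)[of y, unfolded MC_coefficients(2,3,5,6), folded p_def, folded a5_def f4_def]
    have y: "(real n + 1) ^ 10 = y ^ 5"
      by (simp add: y_def flip: power_mult)
    have C: "C\<^sub>2 = a5 - f5"
      unfolding a5_def f5_def p_def by (rule MC_coefficients(7)[symmetric])
    have "MC_error 2 n = R n + lebesgue_tail y - \<rho>\<^sub>1 / (y + \<sigma>\<^sub>1 + \<rho>\<^sub>2 / (y + \<sigma>\<^sub>2))"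
      by (simp add: MC_error_def MC_def MC\<^sub>2_def R_def y_def Let_def)
    then show ?case
      unfolding f_def y y_def[symmetric] mc tail C Q_def
      by (simp add: diff_divide_distrib)
  qed
  have "f \<in> O(\<lambda>n. 1 / (real n + 1) ^ 12)"
  proof -
    obtain C where "C \<ge> 0" "\<And>n. \<bar>R n\<bar> \<le> C / (real n + 1) ^ 12"
      using lebesgue_const_expansion unfolding R_def by blast
    then have "R \<in> O(\<lambda>n. 1 / (real n + 1) ^ 12)"
      by (intro bigoI[of _ C]) auto
    moreover have "(\<lambda>n. c * (1 / (((real n + 1)^2)^4 * Q ((real n + 1)^2)))) \<in> O(\<lambda>n. 1 / (real n + 1) ^ 12)" for c :: real
      unfolding Q_def by real_asymp
    moreover have "(\<lambda>n. c * (1 / (((real n + 1)^2)^5 * Q ((real n + 1)^2)))) \<in> O(\<lambda>n. 1 / (real n + 1) ^ 12)" for c :: real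
      unfolding Q_def by real_asymp
    ultimately show ?thesis unfolding f_def by (intro sum_in_bigo)
  qed
  then show ?thesis
    by (subst landau_o.big.in_cong[OF eq]) simp
qed

theorem theorem3:
  fixes k :: nat
  assumes "k \<in> {1, 2}"
  shows "(\<lambda>n. real n ^ (4 * k + 3) * (MC_error k n - MC_error k (n + 1)))
           \<longlonglongrightarrow> (4 * real k + 2) * MC_limit k
       \<and> (\<lambda>n. real n ^ (4 * k + 2) * MC_error k n) \<longlonglongrightarrow> MC_limit k"
proof -
  have "(\<lambda>n::nat. real n ^ (6 + 1) * (1 / (real n + 1) ^ 6 - 1 / (real n + 2) ^ 6)) \<longlonglongrightarrow> real 6"
    by real_asymp
  note lim1 = limits_of_inverse_power_expansion[OF MC_error_1_bigo this]
  have "(\<lambda>n::nat. real n ^ (10 + 1) * (1 / (real n + 1) ^ 10 - 1 / (real n + 2) ^ 10)) \<longlonglongrightarrow> real 10"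
    by real_asymp
  note lim2 = limits_of_inverse_power_expansion[OF MC_error_2_bigo this]
  from assms consider "k = 1" | "k = 2" by auto
  then show ?thesis
  proof cases
    case 1
    then show ?thesis using lim1 by (simp add: MC_limit_def)
  next
    case 2
    then show ?thesis using lim2 by (simp add: MC_limit_def)
  qed
qed

end
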